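(* Let $\Omega\subseteq\mathbb{C}$ be a domain, let $\mathbf{t}=\{\mathbf{t}(\lambda):\lambda\in\Omega\}$ be a holomorphic form family of type (a) in a Hilbert space $\mathcal{H}$ and let $T=\{T(\lambda):\lambda\in\Omega\}$ be the associated holomorphic operator family of type (B). If there exist $k\in\mathbb{N}_0$, $\mu\in\Omega$ and a core $\mathcal{D}$ of $\mathbf{t}(\mu)$ with $$0\notin\overline{W\big(\mathbf{t}^{(k)}(\mu)\big|_{\mathcal{D}}\big)},$$ then $$\sigma(T)\subseteq W_\Psi(\mathbf{t})=\overline{W(\mathbf{t})}\cap\Omega.$$ If, in addition, the operator family $T$ has constant domain (i.e. $\operatorname{dom}T(\lambda)$ does not depend on $\lambda\in\Omega$), then $$\sigma(T)\subseteq W_\Psi(T)=\overline{W(T)}\cap\Omega.$$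
   Context: $\mathcal{H}$ is a complex Hilbert space. A form (or operator) is sectorial if its numerical range lies in a sector $\{z\in\mathbb{C}:|\arg(z-\gamma)|\le\vartheta\}$ with $\gamma\in\mathbb{R}$, $\vartheta\in[0,\pi/2)$; an operator $A$ is m-sectorial if, in addition, $\rho(A)\cap\{z:|\arg(z-\gamma)|>\vartheta\}\ne\emptyset$. A family $\mathbf{t}$ of densely defined closed sectorial sesquilinear forms in $\mathcal{H}$ is holomorphic of type (a) if its domain $\mathcal{D}_{\mathbf{t}}=\operatorname{dom}\mathbf{t}(\lambda)$ is independent of $\lambda\in\Omega$ and $\lambda\mapsto\mathbf{t}(\lambda)[f]$ is holomorphic on $\Omega$ for every $f\in\mathcal{D}_{\mathbf{t}}$. The family $T$ of m-sectorial operators $T(\lambda)$ associated with $\mathbf{t}(\lambda)$ by the first representation theorem is called holomorphic of type (B). For $k\in\mathbb{N}_0$, $\mathbf{t}^{(k)}(\lambda)[f]:=(\mathbf{t}(\cdot)[f])^{(k)}(\lambda)$, $f\in\operatorname{dom}\mathbf{t}^{(k)}(\lambda):=\mathcal{D}_{\mathbf{t}}$ (the $k$-th derivative with respect to $\lambda$). A core of a closed sectorial form is a subspace of its domain such that the form is the closure of its restriction to it. $W(A)=\{(Af,f):f\in\operatorname{dom}A,\|f\|=1\}$, $W(\mathbf{a})=\{\mathbf{a}[f]:f\in\operatorname{dom}\mathbf{a},\|f\|=1\}$. For families: $W(T)=\{\lambda\in\Omega:0\in W(T(\lambda))\}$, $W(\mathbf{t})=\{\lambda\in\Omega:0\in W(\mathbf{t}(\lambda))\}$,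 $\sigma(T)=\{\lambda\in\Omega:0\in\sigma(T(\lambda))\}$. Pseudo numerical ranges: $W_\Psi(T)=\bigcap_{\varepsilon>0}\bigcup_{B\in L(\mathcal{H}),\|B\|<\varepsilon}W(T+B)$ and $W_\Psi(\mathbf{t})=\bigcap_{\varepsilon>0}\bigcup_{\|\mathbf{b}\|<\varepsilon}W(\mathbf{t}+\mathbf{b})$ (union over bounded sesquilinear forms $\mathbf{b}$ on $\mathcal{H}$, $\|\mathbf{b}\|=\sup_{\|f\|=\|g\|=1}|\mathbf{b}[f,g]|$). *)

theory Defs
  imports "HOL-Complex_Analysis.Complex_Analysis"
begin

section \<open>Complex Hilbert spaces\<close>

text \<open>The inner product is linear in the first and antilinear in the second argument.\<close>

class chilbert_space = banach +
  fixes scaleC :: "complex \<Rightarrow> 'a \<Rightarrow> 'a"  (infixr \<open>*\<^sub>C\<close> 75)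
    and cinner :: "'a \<Rightarrow> 'a \<Rightarrow> complex"
  assumes scaleC_add_right: "a *\<^sub>C (x + y) = a *\<^sub>C x + a *\<^sub>C y"
    and scaleC_add_left: "(a + b) *\<^sub>C x = a *\<^sub>C x + b *\<^sub>C x"
    and scaleC_scaleC: "a *\<^sub>C b *\<^sub>C x = (a * b) *\<^sub>C x"
    and scaleC_of_real: "complex_of_real r *\<^sub>C x = r *\<^sub>R x"
    and cinner_commute: "cinner x y = cnj (cinner y x)"
    and cinner_add_left: "cinner (x + y) z = cinner x z + cinner y z"
    and cinner_scaleC_left: "cinner (a *\<^sub>C x) y = a * cinner x y"
    and cinner_self: "cinner x x = complex_of_real ((norm x)\<^sup>2)"

instantiation complex :: chilbert_space
begin

definition scaleC_complex :: "complex \<Rightarrow> complex \<Rightarrow> complex"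
  where "scaleC_complex a x = a * x"

definition cinner_complex :: "complex \<Rightarrow> complex \<Rightarrow> complex"
  where "cinner_complex x y = x * cnj y"

instance
  by standard
    (simp_all add: scaleC_complex_def cinner_complex_def algebra_simps scaleR_conv_of_real
      complex_norm_square[symmetric] del: of_real_power)

end

definition csubspace :: "'a::chilbert_space set \<Rightarrow> bool"
  where "csubspace S \<longleftrightarrow>
    0 \<in> S \<and> (\<forall>x\<in>S. \<forall>y\<in>S. x + y \<in> S) \<and> (\<forall>c. \<forall>x\<in>S. c *\<^sub>C x \<in> S)"


section \<open>Unbounded operators and forms\<close>

text \<open>
  Operators and forms carry their domain explicitly; the values of \<open>op_app\<close> and \<open>form_app\<close>
  outside the domain carry no information.
\<close>

record 'a oper =
  op_dom :: "'a set"
  op_app :: "'a \<Rightarrow> 'a"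

record 'a form =
  form_dom :: "'a set"
  form_app :: "'a \<Rightarrow> 'a \<Rightarrow> complex"

definition linear_op :: "'a::chilbert_space oper \<Rightarrow> bool"
  where "linear_op A \<longleftrightarrow>
    csubspace (op_dom A) \<and>
    (\<forall>f\<in>op_dom A. \<forall>g\<in>op_dom A. op_app A (f + g) = op_app A f + op_app A g) \<and>
    (\<forall>c. \<forall>f\<in>op_dom A. op_app A (c *\<^sub>C f) = c *\<^sub>C op_app A f)"

definition sesquilinear_form :: "'a::chilbert_space form \<Rightarrow> bool"
  where "sesquilinear_form a \<longleftrightarrow>
    csubspace (form_dom a) \<and>
    (\<forall>f\<in>form_dom a. \<forall>g\<in>form_dom a. \<forall>h\<in>form_dom a.
        form_app a (f + g) h = form_app a f h + form_app a g h \<and>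
        form_app a h (f + g) = form_app a h f + form_app a h g) \<and>
    (\<forall>c. \<forall>f\<in>form_dom a. \<forall>g\<in>form_dom a.
        form_app a (c *\<^sub>C f) g = c * form_app a f g \<and>
        form_app a f (c *\<^sub>C g) = cnj c * form_app a f g)"

definition op_plus :: "'a::chilbert_space oper \<Rightarrow> 'a oper \<Rightarrow> 'a oper"
  where "op_plus A B =
    \<lparr>op_dom = op_dom A \<inter> op_dom B, op_app = (\<lambda>f. op_app A f + op_app B f)\<rparr>"

definition form_plus :: "'a::chilbert_space form \<Rightarrow> 'a form \<Rightarrow> 'a form"
  where "form_plus a b =
    \<lparr>form_dom = form_dom a \<inter> form_dom b, form_app = (\<lambda>f g. form_app a f g + form_app b f g)\<rparr>"

definition form_restrict :: "'a form \<Rightarrow> 'a set \<Rightarrow> 'a form"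
  where "form_restrict a D = \<lparr>form_dom = form_dom a \<inter> D, form_app = form_app a\<rparr>"

definition form_extends :: "'a form \<Rightarrow> 'a form \<Rightarrow> bool"
  where "form_extends b a \<longleftrightarrow>
    form_dom a \<subseteq> form_dom b \<and>
    (\<forall>f\<in>form_dom a. \<forall>g\<in>form_dom a. form_app b f g = form_app a f g)"

definition num_range_op :: "'a::chilbert_space oper \<Rightarrow> complex set"
  where "num_range_op A = {cinner (op_app A f) f | f. f \<in> op_dom A \<and> norm f = 1}"

definition num_range_form :: "'a::chilbert_space form \<Rightarrow> complex set"
  where "num_range_form a = {form_app a f f | f. f \<in> form_dom a \<and> norm f = 1}"

text \<open>Bijectivity of \<open>A - z\<close> together with boundedness of the inverse.\<close>

definition resolvent_set :: "'a::chilbert_space oper \<Rightarrow> complex set"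
  where "resolvent_set A =
    {z. bij_betw (\<lambda>f. op_app A f - z *\<^sub>C f) (op_dom A) UNIV \<and>
        (\<exists>K. \<forall>f\<in>op_dom A. norm f \<le> K * norm (op_app A f - z *\<^sub>C f))}"

definition spectrum :: "'a::chilbert_space oper \<Rightarrow> complex set"
  where "spectrum A = - resolvent_set A"


section \<open>Sectoriality, closedness, cores\<close>

text \<open>Since \<open>Arg 0 = 0\<close>, the vertex belongs to the sector.\<close>

definition sector :: "real \<Rightarrow> real \<Rightarrow> complex set"
  where "sector \<gamma> \<theta> = {z. \<bar>Arg (z - complex_of_real \<gamma>)\<bar> \<le> \<theta>}"

definition sectorial_form :: "'a::chilbert_space form \<Rightarrow> bool"
  where "sectorial_form a \<longleftrightarrow>
    sesquilinear_form a \<and>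
    (\<exists>\<gamma> \<theta>. 0 \<le> \<theta> \<and> \<theta> < pi / 2 \<and> num_range_form a \<subseteq> sector \<gamma> \<theta>)"

definition m_sectorial :: "'a::chilbert_space oper \<Rightarrow> bool"
  where "m_sectorial A \<longleftrightarrow>
    linear_op A \<and>
    (\<exists>\<gamma> \<theta>. 0 \<le> \<theta> \<and> \<theta> < pi / 2 \<and> num_range_op A \<subseteq> sector \<gamma> \<theta> \<and>
           resolvent_set A \<inter> {z. \<bar>Arg (z - complex_of_real \<gamma>)\<bar> > \<theta>} \<noteq> {})"

text \<open>
  Kato's convergence with respect to a form: \<open>u n \<longlonglongrightarrow> f\<close> in the Hilbert space and
  \<open>a[u n - u m] \<longlonglongrightarrow> 0\<close> as \<open>n\<close> and \<open>m\<close> tend to infinity.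
\<close>

definition form_converges :: "'a::chilbert_space form \<Rightarrow> (nat \<Rightarrow> 'a) \<Rightarrow> 'a \<Rightarrow> bool"
  where "form_converges a u f \<longleftrightarrow>
    (\<forall>n. u n \<in> form_dom a) \<and> u \<longlonglongrightarrow> f \<and>
    (\<forall>\<epsilon>>0. \<exists>N. \<forall>n\<ge>N. \<forall>m\<ge>N. cmod (form_app a (u n - u m) (u n - u m)) < \<epsilon>)"

definition closed_sectorial_form :: "'a::chilbert_space form \<Rightarrow> bool"
  where "closed_sectorial_form a \<longleftrightarrow>
    sectorial_form a \<and>
    (\<forall>u f. form_converges a u f \<longrightarrow>
       f \<in> form_dom a \<and> (\<lambda>n. form_app a (u n - f) (u n - f)) \<longlonglongrightarrow> 0)"

text \<open>The closure of a (closable) sectorial form is its smallest closed extension.\<close>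

definition is_form_closure :: "'a::chilbert_space form \<Rightarrow> 'a form \<Rightarrow> bool"
  where "is_form_closure b a \<longleftrightarrow>
    closed_sectorial_form b \<and> form_extends b a \<and>
    (\<forall>c. closed_sectorial_form c \<and> form_extends c a \<longrightarrow> form_extends c b)"

definition form_core :: "'a::chilbert_space form \<Rightarrow> 'a set \<Rightarrow> bool"
  where "form_core a D \<longleftrightarrow>
    csubspace D \<and> D \<subseteq> form_dom a \<and> is_form_closure a (form_restrict a D)"


section \<open>Holomorphic families\<close>

definition holomorphic_type_a :: "complex set \<Rightarrow> (complex \<Rightarrow> 'a::chilbert_space form) \<Rightarrow> bool"
  where "holomorphic_type_a \<Omega> t \<longleftrightarrow>
    (\<forall>z\<in>\<Omega>. closed_sectorial_form (t z) \<and> closure (form_dom (t z)) = UNIV) \<and>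
    (\<forall>z\<in>\<Omega>. \<forall>w\<in>\<Omega>. form_dom (t z) = form_dom (t w)) \<and>
    (\<forall>z\<in>\<Omega>. \<forall>f\<in>form_dom (t z). (\<lambda>w. form_app (t w) f f) holomorphic_on \<Omega>)"

text \<open>
  By the first representation theorem, a densely defined closed sectorial form \<open>a\<close> determines
  exactly one operator \<open>A\<close> with this property.
\<close>

definition associated_op :: "'a::chilbert_space form \<Rightarrow> 'a oper \<Rightarrow> bool"
  where "associated_op a A \<longleftrightarrow>
    m_sectorial A \<and> op_dom A \<subseteq> form_dom a \<and>
    (\<forall>f\<in>op_dom A. \<forall>g\<in>form_dom a. form_app a f g = cinner (op_app A f) g)"

definition associated_type_B ::
  "complex set \<Rightarrow> (complex \<Rightarrow> 'a::chilbert_space form) \<Rightarrow> (complex \<Rightarrow> 'a oper) \<Rightarrow> bool"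
  where "associated_type_B \<Omega> t T \<longleftrightarrow> (\<forall>z\<in>\<Omega>. associated_op (t z) (T z))"

definition form_deriv :: "(complex \<Rightarrow> 'a form) \<Rightarrow> nat \<Rightarrow> complex \<Rightarrow> 'a form"
  where "form_deriv t k z =
    \<lparr>form_dom = form_dom (t z), form_app = (\<lambda>f g. (deriv ^^ k) (\<lambda>w. form_app (t w) f g) z)\<rparr>"

definition fam_num_range_op :: "complex set \<Rightarrow> (complex \<Rightarrow> 'a::chilbert_space oper) \<Rightarrow> complex set"
  where "fam_num_range_op \<Omega> T = {z\<in>\<Omega>. 0 \<in> num_range_op (T z)}"

definition fam_num_range_form :: "complex set \<Rightarrow> (complex \<Rightarrow> 'a::chilbert_space form) \<Rightarrow> complex set"
  where "fam_num_range_form \<Omega> t = {z\<in>\<Omega>. 0 \<in> num_range_form (t z)}"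

definition fam_spectrum :: "complex set \<Rightarrow> (complex \<Rightarrow> 'a::chilbert_space oper) \<Rightarrow> complex set"
  where "fam_spectrum \<Omega> T = {z\<in>\<Omega>. 0 \<in> spectrum (T z)}"


section \<open>Pseudo numerical ranges\<close>

definition bounded_op :: "'a::chilbert_space oper \<Rightarrow> bool"
  where "bounded_op B \<longleftrightarrow> linear_op B \<and> op_dom B = UNIV \<and> bounded_linear (op_app B)"

definition bounded_form :: "'a::chilbert_space form \<Rightarrow> bool"
  where "bounded_form b \<longleftrightarrow>
    sesquilinear_form b \<and> form_dom b = UNIV \<and>
    (\<exists>K. \<forall>f g. cmod (form_app b f g) \<le> K * norm f * norm g)"

text \<open>
  On the zero space this is the supremum of the empty set, an unspecified real; there all
  numerical ranges are empty, so its value is irrelevant below.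
\<close>

definition form_norm :: "'a::chilbert_space form \<Rightarrow> real"
  where "form_norm b = Sup {cmod (form_app b f g) | f g. norm f = 1 \<and> norm g = 1}"

definition pseudo_num_range_op ::
  "complex set \<Rightarrow> (complex \<Rightarrow> 'a::chilbert_space oper) \<Rightarrow> complex set"
  where "pseudo_num_range_op \<Omega> T =
    (\<Inter>\<epsilon>\<in>{0<..}. \<Union>B\<in>{B. bounded_op B \<and> onorm (op_app B) < (\<epsilon>::real)}.
        fam_num_range_op \<Omega> (\<lambda>z. op_plus (T z) B))"

definition pseudo_num_range_form ::
  "complex set \<Rightarrow> (complex \<Rightarrow> 'a::chilbert_space form) \<Rightarrow> complex set"
  where "pseudo_num_range_form \<Omega> t =
    (\<Inter>\<epsilon>\<in>{0<..}. \<Union>b\<in>{b. bounded_form b \<and> form_norm b < \<epsilon>}.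
        fam_num_range_form \<Omega> (\<lambda>z. form_plus (t z) b))"

end

theory Submission
  imports Defs
begin

text \<open>
  Scalar perturbations show that \<open>W\<^sub>\<Psi>(t)\<close> consists of the \<open>\<lambda> \<in> \<Omega>\<close> with \<open>0\<close> in the closure of
  \<open>W(t(\<lambda>))\<close>, and likewise for \<open>T\<close>; this closure condition is the same for \<open>T(\<lambda>)\<close> and \<open>t(\<lambda>)\<close> because \<open>dom T(\<lambda>)\<close> is
  dense in the form norm. The spectrum of an m-sectorial operator lies in the closure of its numerical range,
  because the latter is convex. By Baire's theorem the forms \<open>t(z)\<close>, \<open>z\<close> in a compact set, are uniformly
  bounded in the norm of \<open>t(\<lambda>)\<close>; so Cauchy's estimate makes \<open>t(z)[f]\<close> equicontinuous in \<open>z\<close>, which gives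
  closedness of \<open>W\<^sub>\<Psi>(t)\<close> in \<open>\<Omega>\<close>. Conversely, let \<open>t(\<lambda>)[f\<^sub>n] \<longlonglongrightarrow> 0\<close> with unit vectors \<open>f\<^sub>n\<close>. The functions
  \<open>t(\<cdot>)[f\<^sub>n]\<close> form a normal family; if they had no zeros near \<open>\<lambda>\<close>, then by Hurwitz a subsequence would
  tend to \<open>0\<close> locally uniformly on \<open>\<Omega>\<close> together with its derivatives, contradicting the assumption on the \<open>k\<close>-th derivative.
\<close>


section \<open>Complete norms on a subspace\<close>

text \<open>Type (a) relates \<open>t(z)\<close> and \<open>t(w)\<close> only through the common
  domain \<open>D\<close>, as holomorphy is assumed for each fixed \<open>f\<close> separately. But
  every \<open>t(z)\<close> makes the same \<open>D\<close> a complete normed space continuously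
  embedded in the Hilbert space, and this alone forces all form norms to be equivalent. The locale
  keeps just these properties, because \<open>D\<close> is a mere set on which several norms
  compete. The second obstacle is that the unit vectors realising zeros or small values vary with
  the point, and their form norms are not bounded in advance. They are bounded by the form value
  itself: the square of \<open>p f\<close> is at most \<open>|t(z)[f]| + c\<close>. This makes both
  the absorption argument for closedness and the normal family possible. The final contradiction
  needs the lower bound of the \<open>k\<close>-th derivative on vectors of \<open>D\<close> outside
  the core, so it is extended by density. For \<open>T\<close> the vectors are taken in
  \<open>dom T(\<lambda>)\<close>, and the constant domain puts them into \<open>dom T(w)\<close>
  for the zeros \<open>w\<close> near \<open>\<lambda>\<close>.\<close>

locale complete_norm_on =
  fixes D :: "'a::real_normed_vector set" and p :: "'a \<Rightarrow> real"
  assumes subspace: "subspace D"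
    and norm_le: "x \<in> D \<Longrightarrow> norm x \<le> p x"
    and triangle: "x \<in> D \<Longrightarrow> y \<in> D \<Longrightarrow> p (x + y) \<le> p x + p y"
    and scale: "x \<in> D \<Longrightarrow> p (r *\<^sub>R x) = \<bar>r\<bar> * p x"
    and complete: "(\<And>n. u n \<in> D) \<Longrightarrow> (\<And>e. e > 0 \<Longrightarrow> \<exists>N::nat. \<forall>m\<ge>N. \<forall>n\<ge>N. p (u m - u n) < e)
                    \<Longrightarrow> \<exists>x\<in>D. (\<lambda>n. p (u n - x)) \<longlonglongrightarrow> 0"
begin

lemma diff_mem: "x \<in> D \<Longrightarrow> y \<in> D \<Longrightarrow> x - y \<in> D"
  and add_mem: "x \<in> D \<Longrightarrow> y \<in> D \<Longrightarrow> x + y \<in> D"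
  and scale_mem: "x \<in> D \<Longrightarrow> r *\<^sub>R x \<in> D"
  and zero_mem: "0 \<in> D"
  using subspace by (auto simp: subspace_diff subspace_add subspace_scale subspace_0)

lemma nonneg: "x \<in> D \<Longrightarrow> 0 \<le> p x"
  using norm_le[of x] norm_ge_zero[of x] by linarith

lemma zero [simp]: "p 0 = 0"
  using scale[OF zero_mem, of 0] by simp

lemma eq_zero: "x \<in> D \<Longrightarrow> p x = 0 \<Longrightarrow> x = 0"
  using norm_le[of x] by simp

lemma minus: "x \<in> D \<Longrightarrow> p (- x) = p x"
  using scale[of x "-1"] by simp

lemma commute: "x \<in> D \<Longrightarrow> y \<in> D \<Longrightarrow> p (x - y) = p (y - x)"
  using minus[OF diff_mem, of x y] by simp

lemma triangle_diff: "x \<in> D \<Longrightarrow> y \<in> D \<Longrightarrow> p (x - y) \<le> p x + p y"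
  using triangle[of x "- y"] minus[of y] scale_mem[of y "-1"] by simp

lemma triangle_mid: "x \<in> D \<Longrightarrow> y \<in> D \<Longrightarrow> z \<in> D \<Longrightarrow> p (x - z) \<le> p (x - y) + p (y - z)"
  using triangle[OF diff_mem diff_mem, of x y y z] by simp

lemma limit_norm: "(\<And>n. u n \<in> D) \<Longrightarrow> x \<in> D \<Longrightarrow> (\<lambda>n. p (u n - x)) \<longlonglongrightarrow> 0 \<Longrightarrow> u \<longlonglongrightarrow> x"
  by (rule Lim_null_comparison[of "\<lambda>n. u n - x" "\<lambda>n. p (u n - x)", THEN LIM_zero_cancel])
     (auto intro!: always_eventually norm_le diff_mem)

text \<open>The Baire category theorem for the metric \<open>p (x - y)\<close> on \<open>D\<close>.
  Closedness of the sets is stated by sequences, the form in which the applications verify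
  it.\<close>

lemma baire:
  fixes E :: "nat \<Rightarrow> 'a set"
  assumes E: "\<And>n. E n \<subseteq> D" "D \<subseteq> (\<Union>n. E n)"
    and closed: "\<And>n u x. (\<And>k. u k \<in> E n) \<Longrightarrow> x \<in> D \<Longrightarrow> (\<lambda>k. p (u k - x)) \<longlonglongrightarrow> 0 \<Longrightarrow> x \<in> E n"
  obtains n x r where "x \<in> D" "0 < r" "\<And>y. y \<in> D \<Longrightarrow> p (y - x) < r \<Longrightarrow> y \<in> E n"
proof -
  \<comment> \<open>Nonnegativity and symmetry of a metric are required on the whole type, so the
    distance is set to \<open>0\<close> as soon as a point lies outside \<open>D\<close>.\<close>
  define d where "d x y = (if x \<in> D \<and> y \<in> D then p (x - y) else 0)" for x y
  interpret M: Metric_space D d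
  proof
    show "d x z \<le> d x y + d y z" if "x \<in> D" "y \<in> D" "z \<in> D" for x y z
      using triangle_mid[of x y z] that by (simp add: d_def)
  qed (use nonneg[OF diff_mem] commute eq_zero[OF diff_mem] in \<open>auto simp: d_def\<close>)
  have lim: "limitin M.mtopology u x sequentially \<longleftrightarrow> (\<lambda>n. p (u n - x)) \<longlonglongrightarrow> 0"
    if u: "\<And>n. u n \<in> D" "x \<in> D" for u x
  proof -
    have "0 \<le> p (u n - x)" for n using u by (simp add: nonneg diff_mem)
    with u show ?thesis
      by (simp add: M.limit_metric_sequentially d_def LIMSEQ_iff)
  qed
  have "M.mcomplete"
    unfolding M.mcomplete_def M.MCauchy_def
  proof (intro allI impI, elim conjE)
    fix u :: "nat \<Rightarrow> 'a"
    assume u: "range u \<subseteq> D" and C: "\<forall>e>0. \<exists>N. \<forall>n n'. N \<le> n \<longrightarrow> N \<le> n' \<longrightarrow> d (u n) (u n') < e"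
    then have uD: "u n \<in> D" for n by auto
    have "\<exists>x\<in>D. (\<lambda>n. p (u n - x)) \<longlonglongrightarrow> 0"
    proof (rule complete[OF uD])
      fix e :: real assume "e > 0"
      then obtain N where "\<And>n n'. N \<le> n \<Longrightarrow> N \<le> n' \<Longrightarrow> d (u n) (u n') < e" using C by metis
      then show "\<exists>N. \<forall>m\<ge>N. \<forall>n\<ge>N. p (u m - u n) < e" using uD by (auto simp: d_def)
    qed
    then show "\<exists>x. limitin M.mtopology u x sequentially" using lim uD by blast
  qed
  have cl: "closedin M.mtopology (E n)" for n
    unfolding M.metric_closedin_iff_sequentially_closed
  proof (intro conjI allI impI E)
    fix u x assume *: "range u \<subseteq> E n \<and> limitin M.mtopology u x sequentially"
    then have "x \<in> D" using M.limitin_mspace by blast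
    then show "x \<in> E n" using * closed[of u n x] lim[of u x] E(1)[of n] by blast
  qed
  have "\<exists>n. M.mtopology interior_of (E n) \<noteq> {}"
  proof (rule ccontr)
    assume "\<nexists>n. M.mtopology interior_of E n \<noteq> {}"
    then have "M.mtopology interior_of \<Union>(range E) = {}"
      using cl by (intro M.metric_Baire_category_alt \<open>M.mcomplete\<close>) auto
    moreover have "\<Union>(range E) = D" using E by blast
    ultimately show False using zero_mem M.topspace_mtopology by (metis interior_of_topspace empty_iff)
  qed
  then obtain n x where "x \<in> M.mtopology interior_of (E n)" by blast
  then obtain r where "r > 0" "M.mball x r \<subseteq> E n" "x \<in> D"
    unfolding M.metric_interior_of using E by auto
  then show thesis
    using commute by (intro that[of x r n]) (auto simp: d_def subset_iff)
qed

end

text \<open>The closed graph theorem for the identity from \<open>p\<close> to \<open>q\<close>: a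
  sequence converging in both norms has the same limit in both, since both dominate the ambient
  norm. The argument is that of the open mapping theorem, with Baire, symmetrisation and a geometric
  series of corrections.\<close>

lemma complete_norms_comparable:
  assumes "complete_norm_on D p" and "complete_norm_on D q"
  shows "\<exists>M\<ge>0. \<forall>x\<in>D. q x \<le> M * p x"
proof -
  interpret p: complete_norm_on D p by fact
  interpret q: complete_norm_on D q by fact
  \<comment> \<open>The \<open>p\<close>-closure of the \<open>q\<close>-ball of radius
    \<open>n\<close>.\<close>
  define E where "E n = {x\<in>D. \<forall>e>0. \<exists>w\<in>D. q w \<le> real n \<and> p (x - w) < e}" for n
  obtain n x0 r where x0: "x0 \<in> D" "0 < r" "\<And>y. y \<in> D \<Longrightarrow> p (y - x0) < r \<Longrightarrow> y \<in> E n"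
  proof (rule p.baire[of E])
    show "E n \<subseteq> D" for n by (auto simp: E_def)
    show "D \<subseteq> (\<Union>n. E n)"
    proof
      fix x assume "x \<in> D"
      then have "x \<in> E (nat \<lceil>q x\<rceil>)" using real_nat_ceiling_ge[of "q x"] by (auto simp: E_def intro!: bexI[of _ x])
      then show "x \<in> (\<Union>n. E n)" by blast
    qed
    show "x \<in> E n" if u: "\<And>k. u k \<in> E n" and x: "x \<in> D" and lim: "(\<lambda>k. p (u k - x)) \<longlonglongrightarrow> 0" for n u x
      unfolding E_def
    proof (intro CollectI conjI x allI impI)
      fix e :: real assume "e > 0"
      then have "\<forall>\<^sub>F k in sequentially. p (u k - x) < e / 2" using lim by (intro order_tendstoD(2)[OF lim]) auto
      then obtain k where k: "p (u k - x) < e / 2" by (auto simp: eventually_sequentially)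
      have uk: "u k \<in> D" using u by (auto simp: E_def)
      obtain w where w: "w \<in> D" "q w \<le> real n" "p (u k - w) < e / 2"
        using u[of k] half_gt_zero[OF \<open>e > 0\<close>] unfolding E_def by blast
      have "p (x - w) < e" using p.triangle_mid[OF x uk w(1)] p.commute[OF x uk] k w by linarith
      then show "\<exists>w\<in>D. q w \<le> real n \<and> p (x - w) < e" using w by blast
    qed
  qed (rule that)
  have approx0: "\<exists>w\<in>D. q w \<le> real n \<and> p (y - w) < e" if y: "y \<in> D" "p y < r" and e: "e > 0" for y e
  proof -
    have "x0 + y \<in> E n" "x0 - y \<in> E n"
      using x0 y p.add_mem p.diff_mem p.minus[of y] by auto
    then obtain w1 w2 where w: "w1 \<in> D" "q w1 \<le> real n" "p ((x0 + y) - w1) < e"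
        "w2 \<in> D" "q w2 \<le> real n" "p ((x0 - y) - w2) < e"
      using e unfolding E_def by blast
    \<comment> \<open>\<open>y\<close> is half the difference of \<open>x0 + y\<close> and
      \<open>x0 - y\<close>, both in \<open>E n\<close>; half the difference of their approximants
      approximates \<open>y\<close>, and the centre \<open>x0\<close> cancels.\<close>
    define w where "w = (1/2) *\<^sub>R (w1 - w2)"
    have "w \<in> D" using w by (simp add: w_def p.scale_mem p.diff_mem)
    have qw: "q w \<le> real n"
      using q.triangle_diff[of w1 w2] w q.scale[OF q.diff_mem[of w1 w2], of "1/2"] by (simp add: w_def)
    have eq: "y - w = (1/2) *\<^sub>R ((x0 + y - w1) - (x0 - y - w2))"
      by (simp add: w_def algebra_simps flip: scaleR_add_left)
    have mem: "x0 + y - w1 \<in> D" "x0 - y - w2 \<in> D"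
      using w x0 y by (auto intro: p.diff_mem p.add_mem)
    have "p (y - w) = 1 / 2 * p ((x0 + y - w1) - (x0 - y - w2))"
      unfolding eq p.scale[OF p.diff_mem[OF mem]] by simp
    then have "p (y - w) < e"
      using p.triangle_diff[OF mem] w by linarith
    then show ?thesis using \<open>w \<in> D\<close> qw by blast
  qed
  have approx: "\<exists>w\<in>D. q w \<le> real n / 2^k \<and> p (y - w) < r / 2^(Suc k)" if y: "y \<in> D" "p y < r / 2^k" for y and k :: nat
  proof -
    have "\<exists>w\<in>D. q w \<le> real n \<and> p (2^k *\<^sub>R y - w) < r / 2"
      using y x0 by (intro approx0 p.scale_mem) (auto simp: p.scale field_simps)
    then obtain w where w: "w \<in> D" "q w \<le> real n" "p (2^k *\<^sub>R y - w) < r / 2" by blast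
    have "y - (1/2^k) *\<^sub>R w = (1/2^k) *\<^sub>R (2^k *\<^sub>R y - w)" by (simp add: algebra_simps)
    then have "p (y - (1/2^k) *\<^sub>R w) = p (2^k *\<^sub>R y - w) / 2^k"
      using y w by (simp only:) (simp add: p.scale p.diff_mem p.scale_mem)
    then have "p (y - (1/2^k) *\<^sub>R w) < r / 2^(Suc k)" using w by (simp add: field_simps)
    then show ?thesis using w by (intro bexI[of _ "(1/2^k) *\<^sub>R w"]) (auto simp: q.scale p.scale_mem divide_right_mono)
  qed
  have bound: "q y \<le> 2 * real n" if y: "y \<in> D" "p y < r" for y
  proof -
    \<comment> \<open>\<open>Y k\<close> is the remainder of \<open>y\<close> after \<open>k\<close>
      corrections; the clause for \<open>k = 0\<close> pins the start of the sequence to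
      \<open>y\<close>.\<close>
    have "\<exists>Y. \<forall>k. (Y k \<in> D \<and> p (Y k) < r / 2^k \<and> (k = 0 \<longrightarrow> Y k = y)) \<and> q (Y k - Y (Suc k)) \<le> real n / 2^k"
    proof (rule dependent_nat_choice)
      show "\<exists>x. x \<in> D \<and> p x < r / 2 ^ 0 \<and> (0 = 0 \<longrightarrow> x = y)" using y by auto
      fix x k assume "x \<in> D \<and> p x < r / 2 ^ k \<and> (k = (0::nat) \<longrightarrow> x = y)"
      then obtain w where "w \<in> D" "q w \<le> real n / 2^k" "p (x - w) < r / 2^(Suc k)" "x \<in> D" using approx by blast
      then show "\<exists>z. (z \<in> D \<and> p z < r / 2 ^ Suc k \<and> (Suc k = 0 \<longrightarrow> z = y)) \<and> q (x - z) \<le> real n / 2 ^ k"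
        by (intro exI[of _ "x - w"]) (auto simp: p.diff_mem)
    qed
    then obtain Y where Y: "\<And>k. Y k \<in> D" "\<And>k. p (Y k) < r / 2^k" "Y 0 = y"
        "\<And>k. q (Y k - Y (Suc k)) \<le> real n / 2^k" by blast
    have step: "q (Y k - Y (k + m)) \<le> 2 * real n / 2^k - 2 * real n / 2^(k + m)" for k m
    proof (induction m)
      case (Suc m)
      moreover have "2 * real n / 2 ^ Suc (k + m) = real n / 2 ^ (k + m)" by simp
      ultimately show ?case
        using q.triangle_mid[OF Y(1) Y(1) Y(1), of k "Suc (k + m)" "k + m"] Y(4)[of "k + m"]
        by simp
    qed simp
    have step': "q (Y k - Y (k + m)) \<le> 2 * real n / 2^k" for k m
      using step[of k m] by (smt (verit) divide_nonneg_nonneg of_nat_0_le_iff zero_le_power)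
    have lim0: "(\<lambda>k. C / 2^k) \<longlonglongrightarrow> 0" for C :: real
      using tendsto_mult_right_zero[OF LIMSEQ_power_zero[of "1/2::real"], of C] by (simp add: power_divide)
    have "\<exists>x\<in>D. (\<lambda>k. q (Y k - x)) \<longlonglongrightarrow> 0"
    proof (rule q.complete[OF Y(1)])
      fix e :: real assume "e > 0"
      then obtain N where N: "2 * real n / 2^N < e / 2"
        using order_tendstoD(2)[OF lim0[of "2 * real n"], of "e/2"] by (auto simp: eventually_sequentially)
      have "q (Y m - Y k) < e" if "N \<le> m" "N \<le> k" for m k
        using q.triangle_mid[OF Y(1) Y(1) Y(1), of m k N] q.commute[OF Y(1) Y(1), of m N]
          step'[of N "m - N"] step'[of N "k - N"] that N by simp
      then show "\<exists>N. \<forall>m\<ge>N. \<forall>k\<ge>N. q (Y m - Y k) < e" by blast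
    qed
    then obtain x where x: "x \<in> D" "(\<lambda>k. q (Y k - x)) \<longlonglongrightarrow> 0" by blast
    \<comment> \<open>The remainders tend to \<open>0\<close> in \<open>p\<close> and to some
      \<open>x\<close> in \<open>q\<close>. Both are limits in the ambient norm, so
      \<open>x = 0\<close> and the corrections sum up to \<open>y\<close> in
      \<open>q\<close>.\<close>
    have "(\<lambda>k. p (Y k)) \<longlonglongrightarrow> 0"
      by (rule real_tendsto_sandwich[OF _ _ tendsto_const lim0[of r]])
         (use Y p.nonneg less_imp_le in \<open>blast intro!: always_eventually\<close>)+
    then have "Y \<longlonglongrightarrow> 0" using p.limit_norm[of Y 0] Y p.zero_mem by simp
    moreover have "Y \<longlonglongrightarrow> x" using q.limit_norm[OF Y(1) x] .
    ultimately have "x = 0" using LIMSEQ_unique by blast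
    have "q y \<le> 2 * real n + q (Y k)" for k
      using q.triangle_mid[OF Y(1) Y(1) q.zero_mem, of 0 k] step'[of 0 k] Y(3) by simp
    then show ?thesis
      using tendsto_lowerbound[OF tendsto_add[OF tendsto_const x(2)], of "q y" "2 * real n"] \<open>x = 0\<close>
      by (simp add: always_eventually)
  qed
  \<comment> \<open>A vector rescaled to \<open>p\<close>-norm \<open>r / 2\<close> has
    \<open>q\<close>-norm at most \<open>2 * n\<close>; undoing the scaling gives the factor
    \<open>4 * n / r\<close>.\<close>
  show ?thesis
  proof (intro exI[of _ "4 * real n / r"] conjI ballI)
    show "0 \<le> 4 * real n / r" using x0 by simp
    fix x assume x: "x \<in> D"
    show "q x \<le> 4 * real n / r * p x"
    proof (cases "x = 0")
      case False
      then have px: "p x > 0" using x p.nonneg p.eq_zero by (metis less_eq_real_def)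
      have "q ((r / (2 * p x)) *\<^sub>R x) \<le> 2 * real n"
        using x px x0 by (intro bound p.scale_mem) (auto simp: p.scale)
      then show ?thesis using px x0 x by (simp add: q.scale field_simps)
    qed simp
  qed
qed


section \<open>Sesquilinear forms and convexity of the numerical range\<close>

lemma scaleC_zero_left [simp]: "0 *\<^sub>C x = (0::'a::chilbert_space)"
  using scaleC_of_real[of 0 x] by simp

lemma scaleC_one [simp]: "1 *\<^sub>C x = (x::'a::chilbert_space)"
  using scaleC_of_real[of 1 x] by simp

lemma scaleC_zero_right [simp]: "c *\<^sub>C 0 = (0::'a::chilbert_space)"
  using scaleC_add_right[of c 0 "0::'a"] by simp

lemma scaleC_minus_left: "(- c) *\<^sub>C x = - (c *\<^sub>C (x::'a::chilbert_space))"
  using scaleC_add_left[of c "- c" x] by (simp add: eq_neg_iff_add_eq_0 add.commute)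

lemma scaleC_minus_right: "c *\<^sub>C (- x) = - (c *\<^sub>C (x::'a::chilbert_space))"
  using scaleC_add_right[of c x "- x"] by (simp add: eq_neg_iff_add_eq_0 add.commute)

lemma scaleC_diff_left: "(a - b) *\<^sub>C x = a *\<^sub>C x - b *\<^sub>C (x::'a::chilbert_space)"
  using scaleC_add_left[of a "- b" x] by (simp add: scaleC_minus_left)

lemma scaleC_diff_right: "c *\<^sub>C (x - y) = c *\<^sub>C x - c *\<^sub>C (y::'a::chilbert_space)"
  using scaleC_add_right[of c x "- y"] by (simp add: scaleC_minus_right)

lemma cinner_add_right: "cinner x (y + z) = cinner x y + cinner x (z::'a::chilbert_space)"
  by (metis cinner_add_left cinner_commute complex_cnj_add)

lemma cinner_scaleC_right: "cinner x (c *\<^sub>C y) = cnj c * cinner x (y::'a::chilbert_space)"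
  by (metis cinner_scaleC_left cinner_commute complex_cnj_mult)

lemma cinner_zero_left [simp]: "cinner 0 (x::'a::chilbert_space) = 0"
  using cinner_add_left[of 0 0 x] by simp

lemma cinner_minus_left: "cinner (- x) (y::'a::chilbert_space) = - cinner x y"
  using cinner_add_left[of x "- x" y] by (simp add: eq_neg_iff_add_eq_0 add.commute)

lemma cinner_diff_left: "cinner (x - y) (z::'a::chilbert_space) = cinner x z - cinner y z"
  using cinner_add_left[of x "- y" z] by (simp add: cinner_minus_left)

lemma cinner_zero_right [simp]: "cinner (x::'a::chilbert_space) 0 = 0"
  using cinner_add_right[of x 0 0] by simp

lemma cinner_diff_right: "cinner z (x - y) = cinner z x - cinner z (y::'a::chilbert_space)"
  by (metis cinner_diff_left cinner_commute complex_cnj_diff)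

text \<open>The class gives homogeneity of the norm for real scalars; for complex ones it follows
  from the inner product through \<open>cinner_self\<close>.\<close>

lemma norm_scaleC: "norm (c *\<^sub>C x) = cmod c * norm (x::'a::chilbert_space)"
proof -
  have "complex_of_real ((norm (c *\<^sub>C x))\<^sup>2) = (c * cnj c) * complex_of_real ((norm x)\<^sup>2)"
    by (simp only: cinner_self[symmetric] cinner_scaleC_left cinner_scaleC_right mult_ac)
  also have "\<dots> = complex_of_real ((cmod c * norm x)\<^sup>2)"
    by (simp only: complex_norm_square[symmetric] cinner_self power_mult_distrib of_real_mult)
  finally have "(norm (c *\<^sub>C x))\<^sup>2 = (cmod c * norm x)\<^sup>2" using of_real_eq_iff by blast
  then show ?thesis by (simp add: power2_eq_iff_nonneg)
qed

lemma cinner_Cauchy_Schwarz: "cmod (cinner x y) \<le> norm x * norm (y::'a::chilbert_space)"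
proof (cases "y = 0")
  case False
  \<comment> \<open>\<open>c *\<^sub>C y\<close> is the orthogonal projection of \<open>x\<close>
    onto the line of \<open>y\<close>; the remaining component has nonnegative squared norm.\<close>
  define c where "c = cinner x y / complex_of_real ((norm y)\<^sup>2)"
  have y: "complex_of_real ((norm y)\<^sup>2) \<noteq> 0" using False by simp
  have "cinner (x - c *\<^sub>C y) (c *\<^sub>C y) = 0"
    using y unfolding cinner_diff_left cinner_scaleC_left cinner_scaleC_right cinner_self c_def by simp
  then have "cinner (x - c *\<^sub>C y) (x - c *\<^sub>C y) = cinner (x - c *\<^sub>C y) x"
    using cinner_diff_right[of "x - c *\<^sub>C y" x "c *\<^sub>C y"] by simp
  also have "\<dots> = cinner x x - c * cnj (cinner x y)"
    by (simp only: cinner_diff_left cinner_scaleC_left cinner_commute[of y x])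
  also have "c * cnj (cinner x y) = complex_of_real ((cmod (cinner x y))\<^sup>2 / (norm y)\<^sup>2)"
    by (simp add: c_def complex_norm_square del: of_real_power)
  finally have "(norm (x - c *\<^sub>C y))\<^sup>2 = (norm x)\<^sup>2 - (cmod (cinner x y))\<^sup>2 / (norm y)\<^sup>2"
    unfolding cinner_self of_real_diff[symmetric] of_real_eq_iff .
  then have "(cmod (cinner x y))\<^sup>2 / (norm y)\<^sup>2 \<le> (norm x)\<^sup>2" using zero_le_power2 by (metis diff_ge_0_iff_ge)
  then have "(cmod (cinner x y))\<^sup>2 \<le> (norm x * norm y)\<^sup>2"
    using False by (simp add: field_simps power_mult_distrib)
  then show ?thesis by (rule power2_le_imp_le) simp
qed simp

lemma csubspace_imp_subspace: "csubspace S \<Longrightarrow> subspace S"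
  unfolding csubspace_def subspace_def using scaleC_of_real by metis

lemma csubspace_diff: "csubspace S \<Longrightarrow> x \<in> S \<Longrightarrow> y \<in> S \<Longrightarrow> x - y \<in> S"
  by (simp add: csubspace_imp_subspace subspace_diff)


text \<open>\<open>sesquilinear_form\<close> without the record: inner products, shifted forms and
  \<open>cinner (op_app A f) g\<close> are treated alike, with the domain as a separate
  argument.\<close>

definition sesqui_on :: "'a::chilbert_space set \<Rightarrow> ('a \<Rightarrow> 'a \<Rightarrow> complex) \<Rightarrow> bool"
  where "sesqui_on D b \<longleftrightarrow>
    csubspace D \<and>
    (\<forall>f\<in>D. \<forall>g\<in>D. \<forall>h\<in>D. b (f + g) h = b f h + b g h \<and> b h (f + g) = b h f + b h g) \<and>
    (\<forall>c. \<forall>f\<in>D. \<forall>g\<in>D. b (c *\<^sub>C f) g = c * b f g \<and> b f (c *\<^sub>C g) = cnj c * b f g)"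

lemma sesquilinear_form_iff: "sesquilinear_form a \<longleftrightarrow> sesqui_on (form_dom a) (form_app a)"
  unfolding sesquilinear_form_def sesqui_on_def by blast

lemma sesqui_on_cinner: "csubspace D \<Longrightarrow> sesqui_on D cinner"
  unfolding sesqui_on_def
  by (simp add: cinner_add_left cinner_add_right cinner_scaleC_left cinner_scaleC_right)

lemma sesqui_on_op: "linear_op A \<Longrightarrow> sesqui_on (op_dom A) (\<lambda>f g. cinner (op_app A f) g)"
  unfolding sesqui_on_def linear_op_def
  by (simp add: cinner_add_left cinner_add_right cinner_scaleC_left cinner_scaleC_right)

lemma sesqui_on_add_cinner:
  "sesqui_on D b \<Longrightarrow> sesqui_on D (\<lambda>f g. b f g + c * cinner f g)"
  unfolding sesqui_on_def
  by (simp add: cinner_add_left cinner_add_right cinner_scaleC_left cinner_scaleC_right algebra_simps)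

lemma sesqui_on_mult:
  "sesqui_on D b \<Longrightarrow> sesqui_on D (\<lambda>f g. c * b f g)"
  unfolding sesqui_on_def
  by (simp add: algebra_simps)

context
  fixes D :: "'a::chilbert_space set" and b
  assumes b: "sesqui_on D b"
begin

lemma sesqui_csubspace: "csubspace D"
  using b by (simp add: sesqui_on_def)

lemma sesqui_add_mem: "f \<in> D \<Longrightarrow> g \<in> D \<Longrightarrow> f + g \<in> D"
  and sesqui_scaleC_mem: "f \<in> D \<Longrightarrow> c *\<^sub>C f \<in> D"
  and sesqui_scaleR_mem: "f \<in> D \<Longrightarrow> r *\<^sub>R f \<in> D"
  and sesqui_diff_mem: "f \<in> D \<Longrightarrow> g \<in> D \<Longrightarrow> f - g \<in> D"
  and sesqui_zero_mem: "0 \<in> D"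
  using sesqui_csubspace csubspace_diff scaleC_of_real[of r f] by (auto simp: csubspace_def) metis

lemma sesqui_add_left: "f \<in> D \<Longrightarrow> g \<in> D \<Longrightarrow> h \<in> D \<Longrightarrow> b (f + g) h = b f h + b g h"
  and sesqui_add_right: "f \<in> D \<Longrightarrow> g \<in> D \<Longrightarrow> h \<in> D \<Longrightarrow> b h (f + g) = b h f + b h g"
  and sesqui_scaleC_left: "f \<in> D \<Longrightarrow> g \<in> D \<Longrightarrow> b (c *\<^sub>C f) g = c * b f g"
  and sesqui_scaleC_right: "f \<in> D \<Longrightarrow> g \<in> D \<Longrightarrow> b f (c *\<^sub>C g) = cnj c * b f g"
  using b by (auto simp: sesqui_on_def)

lemma sesqui_minus_left: "f \<in> D \<Longrightarrow> g \<in> D \<Longrightarrow> b (- f) g = - b f g"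
  and sesqui_minus_right: "f \<in> D \<Longrightarrow> g \<in> D \<Longrightarrow> b f (- g) = - b f g"
  using sesqui_scaleC_left[of f g "-1"] sesqui_scaleC_right[of f g "-1"] by (auto simp: scaleC_minus_left)

lemma sesqui_diff_left: "f \<in> D \<Longrightarrow> g \<in> D \<Longrightarrow> h \<in> D \<Longrightarrow> b (f - g) h = b f h - b g h"
  and sesqui_diff_right: "f \<in> D \<Longrightarrow> g \<in> D \<Longrightarrow> h \<in> D \<Longrightarrow> b h (f - g) = b h f - b h g"
  using sesqui_add_left[of f "- g" h] sesqui_add_right[of f "- g" h] sesqui_scaleR_mem[of g "-1"]
  by (auto simp: sesqui_minus_left sesqui_minus_right)

lemma sesqui_diag_scaleC: "f \<in> D \<Longrightarrow> b (c *\<^sub>C f) (c *\<^sub>C f) = complex_of_real ((cmod c)\<^sup>2) * b f f"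
  by (simp add: sesqui_scaleC_left sesqui_scaleC_right sesqui_scaleC_mem complex_norm_square mult.commute del: of_real_power)

lemma sesqui_diag_scaleR: "f \<in> D \<Longrightarrow> b (r *\<^sub>R f) (r *\<^sub>R f) = complex_of_real (r\<^sup>2) * b f f"
  using sesqui_diag_scaleC[of f "complex_of_real r"] by (simp add: scaleC_of_real)

lemma sesqui_diag_zero: "b 0 0 = 0"
  using sesqui_diag_scaleR[OF sesqui_zero_mem, of 0] by simp

lemma sesqui_diag_minus: "f \<in> D \<Longrightarrow> b (- f) (- f) = b f f"
  using sesqui_diag_scaleR[of f "-1"] by simp

lemma sesqui_diag_add:
  "f \<in> D \<Longrightarrow> g \<in> D \<Longrightarrow> b (f + g) (f + g) = b f f + b f g + b g f + b g g"
  by (simp add: sesqui_add_left sesqui_add_right sesqui_add_mem)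

lemma sesqui_diag_diff:
  "f \<in> D \<Longrightarrow> g \<in> D \<Longrightarrow> b (f - g) (f - g) = b f f - b f g - b g f + b g g"
  by (simp add: sesqui_diff_left sesqui_diff_right sesqui_diff_mem)

lemma sesqui_parallelogram:
  "f \<in> D \<Longrightarrow> g \<in> D \<Longrightarrow> b (f + g) (f + g) + b (f - g) (f - g) = 2 * b f f + 2 * b g g"
  by (simp add: sesqui_diag_add sesqui_diag_diff)

lemma sesqui_polarization:
  assumes "f \<in> D" "g \<in> D"
  shows "4 * b f g = b (f + g) (f + g) - b (f - g) (f - g)
    + \<i> * (b (f + \<i> *\<^sub>C g) (f + \<i> *\<^sub>C g) - b (f - \<i> *\<^sub>C g) (f - \<i> *\<^sub>C g))"
  using assms
  by (simp add: sesqui_diag_add sesqui_diag_diff sesqui_scaleC_mem sesqui_scaleC_left sesqui_scaleC_right algebra_simps)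

end

text \<open>The form is first reduced to \<open>b[f] = 0\<close>, \<open>b[g] = 1\<close> with the phase of \<open>g\<close> chosen such that
  \<open>b\<close> is real on the segment joining \<open>f\<close> and \<open>g\<close>; then the intermediate value theorem applies.\<close>

lemma Toeplitz_Hausdorff:
  assumes b: "sesqui_on D b"
  shows "convex {b f f | f. f \<in> D \<and> norm f = 1}"
  unfolding convex_alt
proof (intro ballI allI impI)
  fix y z and \<tau> :: real
  assume yz: "y \<in> {b f f | f. f \<in> D \<and> norm f = 1}" "z \<in> {b f f | f. f \<in> D \<and> norm f = 1}"
    and "0 \<le> \<tau> \<and> \<tau> \<le> 1"
  then have \<tau>: "0 \<le> \<tau>" "\<tau> \<le> 1" by auto
  from yz obtain f g where fg: "f \<in> D" "norm f = 1" "g \<in> D" "norm g = 1" and yz: "y = b f f" "z = b g g"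
    by blast
  have "\<exists>h. (1 - complex_of_real \<tau>) * b f f + complex_of_real \<tau> * b g g = b h h \<and> h \<in> D \<and> norm h = 1"
  proof (cases "b f f = b g g")
    case True
    then show ?thesis using fg by (intro exI[of _ f]) (auto simp: algebra_simps)
  next
    case False
    define w where "w = b g g - b f f"
    \<comment> \<open>An affine change of the form that sends the values at \<open>f\<close> and
      \<open>g\<close> to \<open>0\<close> and \<open>1\<close>.\<close>
    define b' where "b' = (\<lambda>x y. (1 / w) * (b x y + (- b f f) * cinner x y))"
    have "w \<noteq> 0" using False by (simp add: w_def)
    have bb: "b x y = w * b' x y + b f f * cinner x y" for x y
      using \<open>w \<noteq> 0\<close> by (simp add: b'_def)
    have sb: "sesqui_on D b'"
      unfolding b'_def by (intro sesqui_on_mult sesqui_on_add_cinner b)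
    have b'f: "b' f f = 0" using fg by (simp add: b'_def cinner_self)
    have b'g: "b' g g = 1" using fg \<open>w \<noteq> 0\<close> by (simp add: b'_def cinner_self w_def)
    \<comment> \<open>After rotating \<open>g\<close> by \<open>\<omega>\<close> the mixed terms
      have imaginary part \<open>Im (\<omega> * \<delta>)\<close>, and \<open>\<omega>\<close> turns
      \<open>\<delta>\<close> onto the nonnegative real axis.\<close>
    define \<delta> where "\<delta> = b' g f - cnj (b' f g)"
    define \<omega> where "\<omega> = (if \<delta> = 0 then 1 else cnj \<delta> / complex_of_real (cmod \<delta>))"
    have \<omega>: "cmod \<omega> = 1" by (simp add: \<omega>_def norm_divide)
    have \<omega>\<delta>: "Im (\<omega> * \<delta>) = 0"
      by (cases "\<delta> = 0") (simp_all add: \<omega>_def)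
    define k where "k = \<omega> *\<^sub>C g"
    have k: "k \<in> D" "norm k = 1" using fg \<omega> by (auto simp: k_def sesqui_scaleC_mem[OF b] norm_scaleC)
    have b'k: "b' k k = 1"
      unfolding k_def using sesqui_diag_scaleC[OF sb fg(3), of \<omega>] \<omega> b'g by simp
    have "b' f k + b' k f = cnj \<omega> * b' f g + \<omega> * b' g f"
      using sb fg unfolding k_def by (simp add: sesqui_on_def)
    also have "Im \<dots> = Im (\<omega> * \<delta>)"
      by (simp add: \<delta>_def algebra_simps)
    finally have real: "Im (b' f k + b' k f) = 0" using \<omega>\<delta> by simp
    define h where "h s = (1 - s) *\<^sub>R f + s *\<^sub>R k" for s :: real
    have hD: "h s \<in> D" for s using fg k by (simp add: h_def sesqui_add_mem[OF b] sesqui_scaleR_mem[OF b])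
    have b'h: "b' (h s) (h s) = complex_of_real (s * (1 - s)) * (b' f k + b' k f) + complex_of_real (s\<^sup>2)" for s
    proof -
      have "h s = complex_of_real (1 - s) *\<^sub>C f + complex_of_real s *\<^sub>C k" by (simp only: scaleC_of_real h_def)
      then show ?thesis
        using sb fg k b'f b'k
        by (simp add: sesqui_on_def csubspace_def algebra_simps power2_eq_square)
    qed
    have Im_h: "Im (b' (h s) (h s)) = 0" for s
      unfolding b'h using real by simp
    \<comment> \<open>If the segment met \<open>0\<close>, the unit vectors would satisfy
      \<open>f = - k\<close>, although \<open>b'\<close> takes the values \<open>0\<close> and
      \<open>1\<close> on them.\<close>
    have h0: "h s \<noteq> 0" for s
    proof
      assume "h s = 0"
      then have "(1 - s) *\<^sub>R f = - (s *\<^sub>R k)" by (simp add: h_def eq_neg_iff_add_eq_0)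
      then have "norm ((1 - s) *\<^sub>R f) = norm (s *\<^sub>R k)" by simp
      then have "s = 1 / 2" using fg k by auto
      with \<open>h s = 0\<close> have "f + k = 0" by (simp add: h_def flip: scaleR_add_right)
      then have "f = - k" by (simp add: eq_neg_iff_add_eq_0)
      then have "b' f f = b' k k" using sesqui_diag_minus[OF sb k(1)] by simp
      then show False using b'f b'k by simp
    qed
    \<comment> \<open>The Rayleigh quotient along the segment goes continuously from
      \<open>0\<close> to \<open>1\<close>; where it equals \<open>\<tau>\<close>, the normalised
      vector realises the convex combination.\<close>
    define \<rho> where "\<rho> s = Re (b' (h s) (h s)) / (norm (h s))\<^sup>2" for s
    have "continuous_on {0..1} \<rho>"
      using h0 unfolding \<rho>_def b'h unfolding h_def by (intro continuous_intros) auto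
    moreover have "\<rho> 0 \<le> \<tau>" "\<tau> \<le> \<rho> 1"
      using \<tau> k unfolding \<rho>_def b'h by (auto simp: h_def)
    ultimately obtain s where s: "\<rho> s = \<tau>" using IVT'[of \<rho> 0 \<tau> 1] by auto
    define x where "x = (1 / norm (h s)) *\<^sub>R h s"
    have x: "x \<in> D" "norm x = 1" using h0 hD by (auto simp: x_def sesqui_scaleR_mem[OF b])
    have "b' (h s) (h s) = complex_of_real (Re (b' (h s) (h s)))" using Im_h by (simp add: complex_eq_iff)
    also have "\<dots> = complex_of_real (\<tau> * (norm (h s))\<^sup>2)" using s h0 by (auto simp: \<rho>_def field_simps)
    finally have "b (h s) (h s) = (w * complex_of_real \<tau> + b f f) * complex_of_real ((norm (h s))\<^sup>2)"
      unfolding bb[of "h s" "h s"] cinner_self by (simp add: algebra_simps)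
    then have "b x x = w * complex_of_real \<tau> + b f f"
      unfolding x_def sesqui_diag_scaleR[OF b hD] using h0 by (simp add: power_divide)
    then show ?thesis using x by (intro exI[of _ x]) (auto simp: w_def algebra_simps)
  qed
  then show "(1 - \<tau>) *\<^sub>R y + \<tau> *\<^sub>R z \<in> {b f f | f. f \<in> D \<and> norm f = 1}"
    by (auto simp: yz scaleR_conv_of_real)
qed


section \<open>Resolvent sets of m-sectorial operators\<close>

lemma linear_op_diff:
  assumes "linear_op A" "f \<in> op_dom A" "g \<in> op_dom A"
  shows "op_app A (f - g) = op_app A f - op_app A g" "f - g \<in> op_dom A"
proof -
  have "(-1) *\<^sub>C g \<in> op_dom A" "op_app A ((-1) *\<^sub>C g) = (-1) *\<^sub>C op_app A g"
    using assms by (auto simp: linear_op_def csubspace_def)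
  then have g: "- g \<in> op_dom A" "op_app A (- g) = - op_app A g"
    by (simp_all add: scaleC_minus_left)
  have "op_app A (f + - g) = op_app A f + op_app A (- g)"
    using assms g unfolding linear_op_def by blast
  then show "op_app A (f - g) = op_app A f - op_app A g" using g by simp
  show "f - g \<in> op_dom A" using assms by (simp add: linear_op_def csubspace_diff)
qed

text \<open>Cauchy-Schwarz for \<open>(A - z) g\<close> and \<open>g\<close>, where \<open>g\<close>
  is \<open>f\<close> normalised: their inner product is a point of the numerical range minus
  \<open>z\<close>.\<close>

lemma op_lower_bound:
  assumes A: "linear_op A" and f: "f \<in> op_dom A"
    and d: "\<And>w. w \<in> num_range_op A \<Longrightarrow> d \<le> cmod (w - z)"
  shows "d * norm f \<le> norm (op_app A f - z *\<^sub>C f)"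
proof (cases "f = 0")
  case False
  define g where "g = complex_of_real (1 / norm f) *\<^sub>C f"
  have g: "g \<in> op_dom A" "norm g = 1" "op_app A g = complex_of_real (1 / norm f) *\<^sub>C op_app A f"
    using A f False by (auto simp: g_def linear_op_def csubspace_def norm_scaleC norm_divide)
  have "d \<le> cmod (cinner (op_app A g) g - z)" by (intro d) (use g(1,2) in \<open>auto simp: num_range_op_def\<close>)
  also have "cinner (op_app A g) g - z = cinner (op_app A g - z *\<^sub>C g) g"
    using g by (simp add: cinner_diff_left cinner_scaleC_left cinner_self)
  also have "cmod \<dots> \<le> norm (op_app A g - z *\<^sub>C g)"
    using cinner_Cauchy_Schwarz[of "op_app A g - z *\<^sub>C g" g] g by simp
  also have "op_app A g - z *\<^sub>C g = complex_of_real (1 / norm f) *\<^sub>C (op_app A f - z *\<^sub>C f)"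
    unfolding g by (simp add: g_def scaleC_diff_right scaleC_scaleC mult.commute)
  finally show ?thesis using False by (simp add: norm_scaleC norm_divide field_simps)
qed (use A in \<open>auto simp: linear_op_def\<close>)

text \<open>The inverse \<open>R\<close> of \<open>A - z\<close> has Lipschitz constant
  \<open>1 / d\<close>, so \<open>A - w\<close> is inverted as by a Neumann series, here through a
  fixed point. The admissible radius is governed by the distance to the numerical range and cannot
  shrink along a path that keeps away from it.\<close>

lemma resolvent_set_perturb:
  assumes A: "linear_op A" and z: "z \<in> resolvent_set A"
    and d: "\<And>v. v \<in> num_range_op A \<Longrightarrow> d \<le> cmod (v - z)" and w: "cmod (w - z) < d"
  shows "w \<in> resolvent_set A"
proof -
  have bij: "bij_betw (\<lambda>f. op_app A f - z *\<^sub>C f) (op_dom A) UNIV"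
    using z by (auto simp: resolvent_set_def)
  define R where "R = inv_into (op_dom A) (\<lambda>f. op_app A f - z *\<^sub>C f)"
  have R: "R y \<in> op_dom A" "op_app A (R y) - z *\<^sub>C R y = y" for y
    using bij inv_into_into[of y "\<lambda>f. op_app A f - z *\<^sub>C f" "op_dom A"]
      f_inv_into_f[of y "\<lambda>f. op_app A f - z *\<^sub>C f" "op_dom A"]
    unfolding R_def bij_betw_def by auto
  have d0: "d > 0" using w norm_ge_zero[of "w - z"] by linarith
  have lowz: "d * norm f \<le> norm (op_app A f - z *\<^sub>C f)" if "f \<in> op_dom A" for f
    using op_lower_bound[OF A that d] .
  have loww: "(d - cmod (w - z)) * norm f \<le> norm (op_app A f - w *\<^sub>C f)" if "f \<in> op_dom A" for f
  proof (rule op_lower_bound[OF A that])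
    fix v assume "v \<in> num_range_op A"
    then show "d - cmod (w - z) \<le> cmod (v - w)"
      using d[of v] norm_triangle_ineq[of "v - w" "w - z"] by simp
  qed
  have Rdiff: "d * norm (R y - R y') \<le> norm (y - y')" for y y'
  proof -
    have "op_app A (R y - R y') - z *\<^sub>C (R y - R y') = y - y'"
      using R[of y] R[of y'] linear_op_diff(1)[OF A R(1) R(1), of y y']
      by (simp add: scaleC_diff_right algebra_simps)
    then show ?thesis using lowz[OF linear_op_diff(2)[OF A R(1) R(1)], of y y'] by simp
  qed
  have surj: "\<exists>f\<in>op_dom A. op_app A f - w *\<^sub>C f = y" for y
  proof -
    \<comment> \<open>A fixed point solves \<open>(A - z) f = y + (w - z) f\<close>, that is
      \<open>(A - w) f = y\<close>.\<close>
    define F where "F f = R (y + (w - z) *\<^sub>C f)" for f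
    have "\<exists>!f. F f = f"
    proof (rule banach_fix_type[of "cmod (w - z) / d"]; (intro allI)?)
      fix f g
      have "d * norm (F f - F g) \<le> norm ((y + (w - z) *\<^sub>C f) - (y + (w - z) *\<^sub>C g))"
        unfolding F_def by (rule Rdiff)
      also have "\<dots> = cmod (w - z) * norm (f - g)" by (simp add: norm_scaleC flip: scaleC_diff_right)
      finally show "dist (F f) (F g) \<le> cmod (w - z) / d * dist f g"
        using d0 by (simp add: dist_norm field_simps)
    qed (use d0 w in auto)
    then obtain f where f: "F f = f" by blast
    have "f \<in> op_dom A" "op_app A f - z *\<^sub>C f = y + (w - z) *\<^sub>C f"
      using R[of "y + (w - z) *\<^sub>C f"] f by (auto simp: F_def)
    then show ?thesis by (intro bexI[of _ f]) (auto simp: scaleC_diff_left algebra_simps)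
  qed
  have "inj_on (\<lambda>f. op_app A f - w *\<^sub>C f) (op_dom A)"
  proof (rule inj_onI)
    fix f g assume fg: "f \<in> op_dom A" "g \<in> op_dom A" "op_app A f - w *\<^sub>C f = op_app A g - w *\<^sub>C g"
    have "op_app A (f - g) - w *\<^sub>C (f - g) = (op_app A f - w *\<^sub>C f) - (op_app A g - w *\<^sub>C g)"
      using linear_op_diff(1)[OF A fg(1,2)] by (simp add: scaleC_diff_right)
    also have "\<dots> = 0" using fg(3) by simp
    finally have "(d - cmod (w - z)) * norm (f - g) \<le> 0"
      using loww[OF linear_op_diff(2)[OF A fg(1,2)]] by simp
    then show "f = g" using w by (simp add: mult_le_0_iff)
  qed
  then have "bij_betw (\<lambda>f. op_app A f - w *\<^sub>C f) (op_dom A) UNIV"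
    unfolding bij_betw_def using surj by (auto simp: image_iff) metis
  moreover have "\<forall>f\<in>op_dom A. norm f \<le> (1 / (d - cmod (w - z))) * norm (op_app A f - w *\<^sub>C f)"
    using loww w by (auto simp: field_simps)
  ultimately show ?thesis unfolding resolvent_set_def by blast
qed

lemma resolvent_set_connected:
  assumes A: "linear_op A" and H: "connected H" "H \<inter> closure (num_range_op A) = {}"
    and z: "z \<in> H" "z \<in> resolvent_set A" and w: "w \<in> H"
  shows "w \<in> resolvent_set A"
proof (rule connected_induction_simple[OF H(1) z(1) w, of "\<lambda>z. z \<in> resolvent_set A", OF z(2)])
  fix a assume "a \<in> H"
  then have "a \<notin> closure (num_range_op A)" using H by blast
  then obtain e where e: "e > 0" "\<And>v. v \<in> num_range_op A \<Longrightarrow> e \<le> cmod (v - a)"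
    unfolding closure_approachable dist_norm by (metis not_le)
  \<comment> \<open>Points within \<open>e/3\<close> of \<open>a\<close> keep distance
    \<open>2 * e / 3\<close> from the numerical range and are less than \<open>2 * e / 3\<close>
    apart, so each is in reach of the other.\<close>
  show "\<exists>T. openin (top_of_set H) T \<and> a \<in> T \<and>
          (\<forall>x\<in>T. \<forall>y\<in>T. x \<in> resolvent_set A \<longrightarrow> y \<in> resolvent_set A)"
  proof (intro exI[of _ "H \<inter> ball a (e/3)"] conjI ballI impI)
    fix x y assume xy: "x \<in> H \<inter> ball a (e/3)" "y \<in> H \<inter> ball a (e/3)" "x \<in> resolvent_set A"
    have x: "cmod (x - a) < e / 3" and y: "cmod (y - a) < e / 3"
      using xy by (auto simp: dist_norm norm_minus_commute)
    show "y \<in> resolvent_set A"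
    proof (rule resolvent_set_perturb[OF A xy(3), of "2 * e / 3"])
      show "2 * e / 3 \<le> cmod (v - x)" if "v \<in> num_range_op A" for v
        using e(2)[OF that] x norm_triangle_ineq[of "v - x" "x - a"] by simp
      show "cmod (y - x) < 2 * e / 3"
        using x y norm_triangle_ineq4[of "y - a" "x - a"] by simp
    qed
  qed (use e \<open>a \<in> H\<close> in auto)
qed

text \<open>Linear inequalities replace the argument condition, so that closedness and the behaviour
  under translation can be read off. With \<open>\<alpha>\<close> the modulus of the argument, the
  second inequality says \<open>sin (\<alpha> - \<theta>) \<le> 0\<close>.\<close>

lemma sector_iff:
  assumes \<theta>: "0 \<le> \<theta>" "\<theta> < pi / 2"
  shows "z \<in> sector \<gamma> \<theta> \<longleftrightarrow> \<gamma> \<le> Re z \<and> \<bar>Im z\<bar> \<le> tan \<theta> * (Re z - \<gamma>)"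
proof -
  define u where "u = z - complex_of_real \<gamma>"
  define \<alpha> where "\<alpha> = \<bar>Arg u\<bar>"
  have \<alpha>: "0 \<le> \<alpha>" "\<alpha> \<le> pi" using Arg_bounded[of u] by (auto simp: \<alpha>_def)
  have "u = complex_of_real (cmod u) * cis (Arg u)"
    by (metis rcis_cmod_Arg rcis_def)
  from arg_cong[OF this, of Re] arg_cong[OF this, of Im]
  have "Re u = cmod u * cos (Arg u)" "Im u = cmod u * sin (Arg u)" by simp_all
  moreover have "\<bar>sin (Arg u)\<bar> = sin \<alpha>"
    using sin_ge_zero[of \<alpha>] \<alpha> by (auto simp: \<alpha>_def abs_if)
  ultimately have ReIm: "Re u = cmod u * cos \<alpha>" "\<bar>Im u\<bar> = cmod u * sin \<alpha>"
    by (auto simp: \<alpha>_def abs_mult)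
  have cos: "cos \<theta> > 0" using \<theta> by (intro cos_gt_zero_pi) auto
  have tan: "x \<le> tan \<theta> * y \<longleftrightarrow> x * cos \<theta> \<le> y * sin \<theta>" for x y
    using cos by (simp add: tan_def field_simps)
  have "\<alpha> \<le> \<theta> \<longleftrightarrow> 0 \<le> Re u \<and> \<bar>Im u\<bar> \<le> tan \<theta> * Re u"
  proof (cases "u = 0")
    case True
    then show ?thesis using \<theta> by (simp add: \<alpha>_def Arg_zero)
  next
    case False
    have "0 \<le> Re u \<and> \<bar>Im u\<bar> \<le> tan \<theta> * Re u \<longleftrightarrow> 0 \<le> cos \<alpha> \<and> sin (\<alpha> - \<theta>) \<le> 0"
      using False unfolding ReIm tan sin_diff by (simp add: zero_le_mult_iff mult.assoc mult_le_cancel_left)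
    also have "\<dots> \<longleftrightarrow> \<alpha> \<le> \<theta>"
    proof
      assume *: "0 \<le> cos \<alpha> \<and> sin (\<alpha> - \<theta>) \<le> 0"
      then have "\<alpha> \<le> pi / 2" using cos_monotone_0_pi[of "pi/2" \<alpha>] \<alpha> by (cases "\<alpha> \<le> pi / 2") auto
      then show "\<alpha> \<le> \<theta>" using * sin_gt_zero[of "\<alpha> - \<theta>"] \<theta> pi_gt_zero by (cases "\<alpha> \<le> \<theta>") auto
    next
      assume "\<alpha> \<le> \<theta>"
      then show "0 \<le> cos \<alpha> \<and> sin (\<alpha> - \<theta>) \<le> 0"
        using \<alpha> \<theta> sin_ge_zero[of "\<theta> - \<alpha>"] sin_minus[of "\<theta> - \<alpha>"] by (auto intro!: cos_ge_zero)
    qed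
    finally show ?thesis by simp
  qed
  then show ?thesis by (simp add: sector_def \<alpha>_def u_def)
qed

lemma closed_sector: "0 \<le> \<theta> \<Longrightarrow> \<theta> < pi / 2 \<Longrightarrow> closed (sector \<gamma> \<theta>)"
proof -
  assume \<theta>: "0 \<le> \<theta>" "\<theta> < pi / 2"
  have "sector \<gamma> \<theta> = {z. \<gamma> \<le> Re z} \<inter> {z. \<bar>Im z\<bar> \<le> tan \<theta> * (Re z - \<gamma>)}"
    using sector_iff[OF \<theta>] by blast
  then show ?thesis by (auto intro!: closed_Int closed_Collect_le continuous_intros)
qed

lemma m_sectorial_imp_linear_op: "m_sectorial A \<Longrightarrow> linear_op A"
  by (simp add: m_sectorial_def)

text \<open>The definition supplies a single resolvent point \<open>z0\<close> outside the sector.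
  Moving \<open>z0\<close> to the left never enters the sector, and the ray reaches the half-plane
  left of the vertex, which is connected and misses the sector.\<close>

lemma m_sectorialE:
  assumes "m_sectorial A"
  obtains c \<gamma> where "0 \<le> c" "\<And>z. z \<in> closure (num_range_op A) \<Longrightarrow> \<gamma> \<le> Re z \<and> \<bar>Im z\<bar> \<le> c * (Re z - \<gamma>)"
    "{z. Re z < \<gamma>} \<subseteq> resolvent_set A"
proof -
  obtain \<gamma> \<theta> z0 where \<theta>: "0 \<le> \<theta>" "\<theta> < pi / 2" and W: "num_range_op A \<subseteq> sector \<gamma> \<theta>"
    and z0: "z0 \<in> resolvent_set A" "\<bar>Arg (z0 - complex_of_real \<gamma>)\<bar> > \<theta>"
    using assms unfolding m_sectorial_def by blast
  note A = m_sectorial_imp_linear_op[OF assms]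
  have cW: "closure (num_range_op A) \<subseteq> sector \<gamma> \<theta>"
    using closure_minimal[OF W closed_sector[OF \<theta>]] .
  have tan: "0 \<le> tan \<theta>" using \<theta> tan_gt_zero[of \<theta>] by (cases "\<theta> = 0") auto
  define H where "H = (\<lambda>s. z0 - complex_of_real s) ` {0..}"
  have "H \<inter> sector \<gamma> \<theta> = {}"
  proof -
    have "z0 \<in> sector \<gamma> \<theta>" if "s \<ge> 0" "z0 - complex_of_real s \<in> sector \<gamma> \<theta>" for s
      using that mult_left_mono[OF _ tan, of "Re z0 - s - \<gamma>" "Re z0 - \<gamma>"] unfolding sector_iff[OF \<theta>] by auto
    then show ?thesis using z0 by (auto simp: H_def sector_def)
  qed
  moreover have "connected H" unfolding H_def
    by (intro connected_continuous_image continuous_intros convex_connected convex_real_interval)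
  moreover have "z0 \<in> H" by (auto simp: H_def intro!: image_eqI[of _ _ 0])
  ultimately have H: "H \<subseteq> resolvent_set A"
    using resolvent_set_connected[OF A, of H z0] cW z0 by blast
  \<comment> \<open>The shift brings the real part below \<open>- \<bar>\<gamma>\<bar>\<close>,
    hence below \<open>\<gamma>\<close>.\<close>
  define z1 where "z1 = z0 - complex_of_real (\<bar>Re z0\<bar> + \<bar>\<gamma>\<bar> + 1)"
  have z1: "z1 \<in> H" "Re z1 < \<gamma>"
    unfolding H_def z1_def by (intro imageI) auto
  have "{z. Re z < \<gamma>} \<inter> closure (num_range_op A) = {}"
    using cW sector_iff[OF \<theta>, of _ \<gamma>] by fastforce
  moreover have "connected {z. Re z < \<gamma>}"
    by (intro convex_connected convex_halfspace_Re_lt)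
  ultimately have "{z. Re z < \<gamma>} \<subseteq> resolvent_set A"
    using resolvent_set_connected[OF A, of "{z. Re z < \<gamma>}" z1] z1 H by blast
  then show thesis using that[of "tan \<theta>" \<gamma>] tan cW sector_iff[OF \<theta>, of _ \<gamma>] by blast
qed

text \<open>By convexity of the numerical range, a half-plane containing \<open>0\<close> misses it. The resolvent set
  contains the left half-plane \<open>Re z < \<gamma>\<close> and spreads over every half-plane missing the numerical range.\<close>

lemma m_sectorial_zero_in_resolvent_set:
  assumes "m_sectorial A" and "0 \<notin> closure (num_range_op A)"
  shows "0 \<in> resolvent_set A"
proof -
  note A = m_sectorial_imp_linear_op[OF assms(1)]
  obtain \<gamma> c where c: "0 \<le> c"
    and sec: "\<And>z. z \<in> closure (num_range_op A) \<Longrightarrow> \<gamma> \<le> Re z \<and> \<bar>Im z\<bar> \<le> c * (Re z - \<gamma>)"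
    and left: "{z. Re z < \<gamma>} \<subseteq> resolvent_set A"
    by (rule m_sectorialE[OF assms(1)]) blast
  have "convex (num_range_op A)"
    using Toeplitz_Hausdorff[OF sesqui_on_op[OF A]] unfolding num_range_op_def .
  then obtain a b where ab: "inner a 0 < b" "\<And>x. x \<in> closure (num_range_op A) \<Longrightarrow> inner a x > b"
    using separating_hyperplane_closed_point[OF convex_closure closed_closure assms(2)] by metis
  define H where "H = {z. inner a z < b}"
  have H: "connected H" "H \<inter> closure (num_range_op A) = {}" "0 \<in> H"
    using ab less_asym by (auto simp: H_def intro!: convex_connected convex_halfspace_lt)
  have "\<exists>z\<in>H. z \<in> resolvent_set A"
  proof (cases "\<exists>z\<in>H. Re z < \<gamma>")
    case True
    then show ?thesis using left by blast
  next
    \<comment> \<open>No point of \<open>H\<close> lies left of \<open>\<gamma>\<close>, which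
      forces \<open>H\<close> to be the half-plane to the right of a vertical line:
      \<open>Im a = 0\<close> and \<open>Re a < 0\<close>.\<close>
    case False
    have Im_a: "Im a = 0"
    proof (rule ccontr)
      assume "Im a \<noteq> 0"
      \<comment> \<open>This point satisfies \<open>inner a z = 0 < b\<close> and lies left of
        \<open>\<gamma>\<close>.\<close>
      then have "Complex (\<gamma> - 1) (- (Re a * (\<gamma> - 1)) / Im a) \<in> H"
        using ab by (simp add: H_def inner_complex_def)
      then show False using False by fastforce
    qed
    have Re_a: "Re a < 0"
    proof (rule ccontr)
      assume "\<not> Re a < 0"
      then have "complex_of_real (min (\<gamma> - 1) 0) \<in> H"
        using ab Im_a by (auto simp: H_def inner_complex_def min_def intro: le_less_trans[OF mult_nonneg_nonpos])
      then show False using False by fastforce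
    qed
    \<comment> \<open>The numerical range now has real parts between \<open>\<gamma>\<close> and
      \<open>0\<close>, hence imaginary parts below \<open>M\<close>. The half-plane above it joins
      the region left of \<open>\<gamma>\<close> to the point \<open>Complex 0 (M + 1)\<close> of
      \<open>H\<close>.\<close>
    define M where "M = c * \<bar>\<gamma>\<bar> + 1"
    define H2 where "H2 = {z. Im z > M}"
    have "Im x < M" if "x \<in> closure (num_range_op A)" for x
    proof -
      have "Re a * Re x > 0" using ab(1) ab(2)[OF that] Im_a by (simp add: inner_complex_def)
      then have "Re x < 0" using Re_a by (simp add: zero_less_mult_iff)
      then have "c * (Re x - \<gamma>) \<le> c * \<bar>\<gamma>\<bar>" using c by (intro mult_left_mono) auto
      then show ?thesis using sec[OF that] by (auto simp: M_def)
    qed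
    then have H2: "connected H2" "H2 \<inter> closure (num_range_op A) = {}"
      by (auto simp: H2_def intro!: convex_connected convex_halfspace_Im_gt) (metis less_asym)
    have "Complex (\<gamma> - 1) (M + 1) \<in> H2" "Complex (\<gamma> - 1) (M + 1) \<in> resolvent_set A"
      using left by (auto simp: H2_def)
    moreover have "Complex 0 (M + 1) \<in> H2" by (simp add: H2_def)
    ultimately have "Complex 0 (M + 1) \<in> resolvent_set A"
      using resolvent_set_connected[OF A H2] by blast
    moreover have "Complex 0 (M + 1) \<in> H"
      using ab Im_a by (simp add: H_def inner_complex_def)
    ultimately show ?thesis by blast
  qed
  then show ?thesis using resolvent_set_connected[OF A H(1,2)] H(3) by blast
qed


section \<open>The norm of a closed sectorial form\<close>

text \<open>With \<open>x = f + g\<close> and \<open>y = f - g\<close> the difference is half of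
  \<open>b x y + b y x\<close>. The factor \<open>s\<close> rescales \<open>x\<close> and
  \<open>y\<close> to equal \<open>p\<close>-norm without changing this sum, so polarisation loses
  only a constant. The norm \<open>p\<close> is not tied to \<open>b\<close>, which lets one norm
  serve the forms at all points.\<close>

lemma sesqui_diff_bound:
  assumes "complete_norm_on D p" and sesqui: "sesqui_on D b"
    and M: "\<And>f. f \<in> D \<Longrightarrow> cmod (b f f) \<le> M * (p f)\<^sup>2" and fg: "f \<in> D" "g \<in> D"
  shows "cmod (b f f - b g g) \<le> 2 * M * p (f + g) * p (f - g)"
proof -
  interpret complete_norm_on D p by fact
  have b: "b (x + y) (x + y) - b (x - y) (x - y) = 2 * (b x y + b y x)" if "x \<in> D" "y \<in> D" for x y
    using that by (simp add: sesqui_diag_add[OF sesqui] sesqui_diag_diff[OF sesqui])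
  have scale_b: "b (r *\<^sub>R x) y = r * b x y \<and> b x (r *\<^sub>R y) = r * b x y" if "x \<in> D" "y \<in> D" for x y r
    using sesqui_scaleC_left[OF sesqui that, of r] sesqui_scaleC_right[OF sesqui that, of r]
    by (simp add: scaleC_of_real)
  define x y where "x = f + g" and "y = f - g"
  have xy: "x \<in> D" "y \<in> D" using fg by (auto simp: x_def y_def add_mem diff_mem)
  have fx: "f = (1/2) *\<^sub>R x + (1/2) *\<^sub>R y" and gx: "g = (1/2) *\<^sub>R x - (1/2) *\<^sub>R y"
    by (simp_all add: x_def y_def algebra_simps flip: scaleR_add_left)
  have diff: "b f f - b g g = (b x y + b y x) / 2"
    unfolding fx gx using xy by (subst b) (auto simp: scale_b scale_mem)
  show ?thesis
  proof (cases "x = 0 \<or> y = 0")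
    case True
    have "b 0 z = 0" "b z 0 = 0" if "z \<in> D" for z
      using scale_b[OF that that, of 0] by auto
    then show ?thesis using True xy diff unfolding x_def[symmetric] y_def[symmetric] by auto
  next
    case False
    then have px: "p x > 0" and py: "p y > 0" using xy nonneg eq_zero by (metis less_eq_real_def)+
    define s where "s = sqrt (p y / p x)"
    have s: "s > 0" "s * p x = sqrt (p x * p y)" "p y / s = sqrt (p x * p y)"
      using px py by (auto simp: s_def real_sqrt_divide real_sqrt_mult field_simps)
    define u v where "u = s *\<^sub>R x" and "v = (1/s) *\<^sub>R y"
    have uv: "u \<in> D" "v \<in> D" using xy by (auto simp: u_def v_def scale_mem)
    have pu: "p u = sqrt (p x * p y)" and pv: "p v = sqrt (p x * p y)"
      using s xy by (auto simp: u_def v_def scale)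
    have pm: "(p w)\<^sup>2 \<le> 4 * (p x * p y)" if w: "w \<in> D" "p w \<le> p u + p v" for w
    proof -
      have "(p w)\<^sup>2 \<le> (2 * sqrt (p x * p y))\<^sup>2"
        using w pu pv by (intro power_mono nonneg) auto
      then show ?thesis using px py by (simp add: power_mult_distrib)
    qed
    have M0: "M \<ge> 0" using M[OF xy(1)] px by (smt (verit) norm_ge_zero zero_less_power zero_le_mult_iff)
    have bd: "cmod (b w w) \<le> M * (4 * (p x * p y))" if "w \<in> D" "p w \<le> p u + p v" for w
      using M[OF that(1)] mult_left_mono[OF pm[OF that] M0] by linarith
    have "4 * (b f f - b g g) = 2 * (b x y + b y x)" unfolding diff by simp
    also have "\<dots> = 2 * (b u v + b v u)"
      using s xy by (simp add: u_def v_def scale_b scale_mem)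
    also have "\<dots> = b (u + v) (u + v) - b (u - v) (u - v)" using b[OF uv] by simp
    finally have "4 * (b f f - b g g) = b (u + v) (u + v) - b (u - v) (u - v)" .
    then have "4 * cmod (b f f - b g g) = cmod (b (u + v) (u + v) - b (u - v) (u - v))"
      by (metis norm_mult norm_numeral)
    also have "\<dots> \<le> M * (4 * (p x * p y)) + M * (4 * (p x * p y))"
      using uv by (intro norm_triangle_le_diff add_mono bd triangle triangle_diff add_mem diff_mem)
    finally show ?thesis by (simp add: x_def y_def mult_ac)
  qed
qed

text \<open>The form norm: \<open>c\<close> shifts the form into the right half-plane, and
  \<open>C\<close> compares the modulus of the form with the shifted real part. As the square of
  \<open>p\<close> is a quadratic form, the parallelogram law becomes available.\<close>

locale closed_form_norm = complete_norm_on D p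
  for D :: "'a::chilbert_space set" and p +
  fixes a :: "'a \<Rightarrow> 'a \<Rightarrow> complex" and c C :: real
  assumes sesqui: "sesqui_on D a"
    and sq: "f \<in> D \<Longrightarrow> (p f)\<^sup>2 = Re (a f f) + c * (norm f)\<^sup>2"
    and bound: "f \<in> D \<Longrightarrow> cmod (a f f) \<le> C * (p f)\<^sup>2"
    and c_nonneg: "0 \<le> c" and C_nonneg: "0 \<le> C"
begin

lemma csubspace: "csubspace D"
  using sesqui by (rule sesqui_csubspace)

lemma scaleC_mem: "f \<in> D \<Longrightarrow> k *\<^sub>C f \<in> D"
  using sesqui by (rule sesqui_scaleC_mem)

lemma scaleC: "f \<in> D \<Longrightarrow> p (k *\<^sub>C f) = cmod k * p f"
proof -
  assume f: "f \<in> D"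
  have "(p (k *\<^sub>C f))\<^sup>2 = (cmod k * p f)\<^sup>2"
    using f by (simp add: sq scaleC_mem sesqui_diag_scaleC[OF sesqui] norm_scaleC power_mult_distrib algebra_simps
          del: of_real_power)
  then show ?thesis using f nonneg scaleC_mem by (simp add: power2_eq_iff_nonneg)
qed

lemma parallelogram:
  assumes "f \<in> D" "g \<in> D"
  shows "(p (f + g))\<^sup>2 + (p (f - g))\<^sup>2 = 2 * (p f)\<^sup>2 + 2 * (p g)\<^sup>2"
proof -
  have "Re (a (f + g) (f + g)) + Re (a (f - g) (f - g)) = 2 * Re (a f f) + 2 * Re (a g g)"
    using arg_cong[OF sesqui_parallelogram[OF sesqui assms], of Re] by simp
  moreover have "(norm (f + g))\<^sup>2 + (norm (f - g))\<^sup>2 = 2 * (norm f)\<^sup>2 + 2 * (norm g)\<^sup>2"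
    using arg_cong[OF sesqui_parallelogram[OF sesqui_on_cinner[OF csubspace] assms], of Re]
    by (simp add: cinner_self del: of_real_power)
  then have "c * (norm (f + g))\<^sup>2 + c * (norm (f - g))\<^sup>2 = 2 * (c * (norm f)\<^sup>2) + 2 * (c * (norm g)\<^sup>2)"
    by (metis (no_types, opaque_lifting) distrib_left mult.left_commute)
  ultimately show ?thesis using assms by (simp add: sq add_mem diff_mem)
qed

text \<open>Polarisation needs two differences, for \<open>h = g\<close> and
  \<open>h = \<i> *\<^sub>C g\<close>. Each costs \<open>8 * M * p f * p h\<close>, and the factor
  \<open>4\<close> on the left leaves \<open>4 * M\<close>.\<close>

lemma sesqui_bound:
  assumes b: "sesqui_on D b" and M: "\<And>f. f \<in> D \<Longrightarrow> cmod (b f f) \<le> M * (p f)\<^sup>2" and fg: "f \<in> D" "g \<in> D"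
  shows "cmod (b f g) \<le> 4 * M * p f * p g"
proof -
  have *: "cmod (b (f + h) (f + h) - b (f - h) (f - h)) \<le> 8 * M * p f * p h" if "h \<in> D" for h
  proof -
    have "p ((f + h) + (f - h)) = 2 * p f" "p ((f + h) - (f - h)) = 2 * p h"
      using scale[OF fg(1), of 2] scale[OF that, of 2] by (simp_all add: scaleR_2)
    then show ?thesis using sesqui_diff_bound[OF complete_norm_on_axioms b M add_mem[OF fg(1) that] diff_mem[OF fg(1) that]] by simp
  qed
  have "4 * cmod (b f g) = cmod (4 * b f g)" by (simp add: norm_mult)
  also have "\<dots> \<le> 8 * M * p f * p g + 8 * M * p f * p (\<i> *\<^sub>C g)"
    unfolding sesqui_polarization[OF b fg]
    by (intro norm_triangle_le add_mono) (use * fg scaleC_mem in \<open>auto simp: norm_mult\<close>)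
  finally show ?thesis using fg by (simp add: scaleC)
qed

text \<open>Translates between Kato's convergence, in which closedness is phrased, and convergence
  in \<open>p\<close>.\<close>

lemma form_tendsto_zero_iff:
  assumes "\<And>n. u n \<in> D" "f \<in> D" "u \<longlonglongrightarrow> f"
  shows "(\<lambda>n. p (u n - f)) \<longlonglongrightarrow> 0 \<longleftrightarrow> (\<lambda>n. a (u n - f) (u n - f)) \<longlonglongrightarrow> 0"
proof
  assume "(\<lambda>n. p (u n - f)) \<longlonglongrightarrow> 0"
  then have "(\<lambda>n. C * (p (u n - f))\<^sup>2) \<longlonglongrightarrow> C * 0\<^sup>2" by (intro tendsto_intros)
  then have "(\<lambda>n. C * (p (u n - f))\<^sup>2) \<longlonglongrightarrow> 0" by simp
  then show "(\<lambda>n. a (u n - f) (u n - f)) \<longlonglongrightarrow> 0"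
    by (rule Lim_null_comparison[rotated]) (use assms bound[OF diff_mem] in simp_all)
next
  assume "(\<lambda>n. a (u n - f) (u n - f)) \<longlonglongrightarrow> 0"
  moreover have "(\<lambda>n. norm (u n - f)) \<longlonglongrightarrow> 0" using assms(3) by (simp add: LIM_zero tendsto_norm_zero)
  ultimately have "(\<lambda>n. sqrt (Re (a (u n - f) (u n - f)) + c * (norm (u n - f))\<^sup>2)) \<longlonglongrightarrow> sqrt (Re 0 + c * 0\<^sup>2)"
    by (intro tendsto_intros)
  moreover have "p (u n - f) = sqrt (Re (a (u n - f) (u n - f)) + c * (norm (u n - f))\<^sup>2)" for n
    using assms by (simp add: sq[symmetric] diff_mem nonneg)
  ultimately show "(\<lambda>n. p (u n - f)) \<longlonglongrightarrow> 0" by simp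
qed

end

text \<open>Only the real part of \<open>b\<close> enters \<open>p\<close>, so the triangle
  inequality rests on positivity at one combination of \<open>f\<close> and \<open>g\<close> instead
  of a Cauchy-Schwarz inequality for \<open>b\<close>.\<close>

lemma complete_norm_on_form_sqrt:
  assumes b: "sesqui_on D b" and coercive: "\<And>f. f \<in> D \<Longrightarrow> (norm f)\<^sup>2 \<le> Re (b f f)"
    and p_def: "\<And>f. p f = sqrt (Re (b f f))"
    and complete: "\<And>u. (\<And>n. u n \<in> D) \<Longrightarrow> (\<And>e. e > 0 \<Longrightarrow> \<exists>N::nat. \<forall>m\<ge>N. \<forall>n\<ge>N. p (u m - u n) < e)
                      \<Longrightarrow> \<exists>x\<in>D. (\<lambda>n. p (u n - x)) \<longlonglongrightarrow> 0"
  shows "complete_norm_on D p"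
proof
  have psq: "(p f)\<^sup>2 = Re (b f f)" if "f \<in> D" for f
    using coercive[OF that] by (auto simp: p_def intro!: real_sqrt_pow2 order_trans[OF zero_le_power2])
  have p0: "0 \<le> p f" if "f \<in> D" for f
    using psq[OF that] coercive[OF that] by (auto simp: p_def intro!: real_sqrt_ge_zero order_trans[OF zero_le_power2])
  show "subspace D" using sesqui_csubspace[OF b] by (rule csubspace_imp_subspace)
  show norm_le: "norm x \<le> p x" if "x \<in> D" for x
    by (rule power2_le_imp_le) (use coercive[OF that] p0[OF that] psq[OF that] in simp_all)
  show "p (r *\<^sub>R x) = \<bar>r\<bar> * p x" if "x \<in> D" for x r
    using that by (simp add: p_def sesqui_diag_scaleR[OF b] real_sqrt_mult del: of_real_power)
  show "p (f + g) \<le> p f + p g" if fg: "f \<in> D" "g \<in> D" for f g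
  proof (cases "f = 0 \<or> g = 0")
    case True
    then show ?thesis using p0 fg sesqui_diag_zero[OF b] by (auto simp: p_def)
  next
    case False
    then have pos: "p f > 0" "p g > 0"
      using norm_le[OF fg(1)] norm_le[OF fg(2)] by (smt (verit) zero_less_norm_iff)+
    define R where "R = Re (b f g) + Re (b g f)"
    \<comment> \<open>These weights make both pure terms equal to the square of
      \<open>p f * p g\<close>, which leaves \<open>R \<le> 2 * p f * p g\<close>.\<close>
    let ?h = "complex_of_real (p g) *\<^sub>C f - complex_of_real (p f) *\<^sub>C g"
    have "0 \<le> Re (b ?h ?h)"
      using coercive[of ?h] fg by (auto simp: sesqui_diff_mem[OF b] sesqui_scaleC_mem[OF b] intro: order_trans[OF zero_le_power2])
    also have "Re (b ?h ?h) = (p g)\<^sup>2 * Re (b f f) - p f * p g * R + (p f)\<^sup>2 * Re (b g g)"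
      using fg by (simp add: sesqui_diag_diff[OF b] sesqui_scaleC_mem[OF b] sesqui_scaleC_left[OF b]
          sesqui_scaleC_right[OF b] R_def algebra_simps power2_eq_square)
    also have "\<dots> = p f * p g * (2 * p f * p g - R)"
      using fg by (simp add: psq[symmetric] algebra_simps power2_eq_square)
    finally have "R \<le> 2 * p f * p g"
      using zero_le_mult_iff[of "p f * p g" "2 * p f * p g - R"] mult_pos_pos[OF pos] by linarith
    moreover have "(p (f + g))\<^sup>2 = (p f)\<^sup>2 + R + (p g)\<^sup>2"
      using fg by (simp add: psq sesqui_add_mem[OF b] sesqui_diag_add[OF b] R_def)
    ultimately have "(p (f + g))\<^sup>2 \<le> (p f + p g)\<^sup>2" by (simp add: power2_sum)
    then show ?thesis
      by (rule power2_le_imp_le) (use p0[OF fg(1)] p0[OF fg(2)] in simp)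
  qed
qed (rule complete)

text \<open>A \<open>p\<close>-Cauchy sequence converges in the Hilbert space and then in Kato's
  sense, so closedness of the form yields completeness of \<open>p\<close>.\<close>

lemma closed_sectorial_form_norm:
  assumes "closed_sectorial_form a"
  shows "\<exists>p c C. closed_form_norm (form_dom a) p (form_app a) c C"
proof -
  have s: "sesqui_on (form_dom a) (form_app a)"
    using assms by (simp add: closed_sectorial_form_def sectorial_form_def sesquilinear_form_iff)
  obtain \<gamma> \<theta> where \<theta>: "0 \<le> \<theta>" "\<theta> < pi / 2" and W: "num_range_form a \<subseteq> sector \<gamma> \<theta>"
    using assms by (auto simp: closed_sectorial_form_def sectorial_form_def)
  have tan: "0 \<le> tan \<theta>" using \<theta> tan_gt_zero[of \<theta>] by (cases "\<theta> = 0") auto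
  have sec: "\<gamma> * (norm f)\<^sup>2 \<le> Re (form_app a f f)"
    "\<bar>Im (form_app a f f)\<bar> \<le> tan \<theta> * (Re (form_app a f f) - \<gamma> * (norm f)\<^sup>2)" if f: "f \<in> form_dom a" for f
  proof -
    define g where "g = (1 / norm f) *\<^sub>R f"
    have fg: "form_app a f f = complex_of_real ((norm f)\<^sup>2) * form_app a g g" if "f \<noteq> 0"
      using that f by (simp add: g_def sesqui_diag_scaleR[OF s] power_divide)
    have "form_app a g g \<in> sector \<gamma> \<theta>" if "f \<noteq> 0"
    proof -
      have "g \<in> form_dom a" "norm g = 1" using that f by (auto simp: g_def sesqui_scaleR_mem[OF s])
      then show ?thesis using W by (auto simp: num_range_form_def)
    qed
    then have *: "\<gamma> \<le> Re (form_app a g g)" "\<bar>Im (form_app a g g)\<bar> \<le> tan \<theta> * (Re (form_app a g g) - \<gamma>)" if "f \<noteq> 0"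
      using that unfolding sector_iff[OF \<theta>] by auto
    have "\<gamma> * (norm f)\<^sup>2 \<le> Re (form_app a f f) \<and>
      \<bar>Im (form_app a f f)\<bar> \<le> tan \<theta> * (Re (form_app a f f) - \<gamma> * (norm f)\<^sup>2)"
    proof (cases "f = 0")
      case False
      have pos: "0 \<le> (norm f)\<^sup>2" by simp
      show ?thesis unfolding fg[OF False]
        using mult_right_mono[OF *(1)[OF False] pos] mult_right_mono[OF *(2)[OF False] pos]
        by (simp add: algebra_simps abs_mult del: of_real_power)
    qed (use sesqui_diag_zero[OF s] in simp)
    then show "\<gamma> * (norm f)\<^sup>2 \<le> Re (form_app a f f)"
      "\<bar>Im (form_app a f f)\<bar> \<le> tan \<theta> * (Re (form_app a f f) - \<gamma> * (norm f)\<^sup>2)" by auto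
  qed
  \<comment> \<open>The lower bound \<open>\<gamma>\<close> of the real part on unit vectors becomes
    at least \<open>1\<close> after this shift, so \<open>p\<close> dominates the norm.\<close>
  define c where "c = 1 + \<bar>\<gamma>\<bar>"
  define b where "b = (\<lambda>f g. form_app a f g + complex_of_real c * cinner f g)"
  define p where "p = (\<lambda>f. sqrt (Re (b f f)))"
  have b: "sesqui_on (form_dom a) b" unfolding b_def by (rule sesqui_on_add_cinner[OF s])
  have Re_b: "Re (b f f) = Re (form_app a f f) + c * (norm f)\<^sup>2" for f
    by (simp add: b_def cinner_self del: of_real_power)
  have coercive: "(norm f)\<^sup>2 \<le> Re (b f f)" if "f \<in> form_dom a" for f
  proof -
    have "(1 - c) * (norm f)\<^sup>2 \<le> \<gamma> * (norm f)\<^sup>2" by (intro mult_right_mono) (auto simp: c_def)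
    then show ?thesis using sec(1)[OF that] unfolding Re_b by (simp add: algebra_simps)
  qed
  have psq: "(p f)\<^sup>2 = Re (b f f)" if "f \<in> form_dom a" for f
    using coercive[OF that] by (auto simp: p_def intro!: real_sqrt_pow2 order_trans[OF zero_le_power2])
  have normp: "norm f \<le> p f" if "f \<in> form_dom a" for f
    using coercive[OF that] by (auto simp: p_def intro!: real_le_rsqrt)
  \<comment> \<open>Relative to the square of \<open>p f\<close>, the real part is bounded by
    \<open>1 + c\<close> and the imaginary part by \<open>tan \<theta>\<close>.\<close>
  define C where "C = 1 + c + tan \<theta>"
  have bound: "cmod (form_app a f f) \<le> C * (p f)\<^sup>2" if f: "f \<in> form_dom a" for f
  proof -
    have "c * (norm f)\<^sup>2 \<le> c * (p f)\<^sup>2"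
      using normp[OF f] by (intro mult_left_mono power_mono) (auto simp: c_def)
    moreover have "0 \<le> c * (norm f)\<^sup>2" by (simp add: c_def)
    ultimately have "\<bar>Re (form_app a f f)\<bar> \<le> (p f)\<^sup>2 + c * (p f)\<^sup>2"
      using psq[OF f] Re_b[of f] zero_le_power2[of "p f"] by linarith
    moreover have "- \<gamma> * (norm f)\<^sup>2 \<le> c * (norm f)\<^sup>2" by (intro mult_right_mono) (auto simp: c_def)
    then have "tan \<theta> * (Re (form_app a f f) - \<gamma> * (norm f)\<^sup>2) \<le> tan \<theta> * (p f)\<^sup>2"
      using psq[OF f] Re_b[of f] tan by (intro mult_left_mono) auto
    ultimately show ?thesis
      using cmod_le[of "form_app a f f"] sec(2)[OF f] by (simp add: C_def algebra_simps)
  qed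
  have "complete_norm_on (form_dom a) p"
  proof (rule complete_norm_on_form_sqrt[OF b])
    show "(norm f)\<^sup>2 \<le> Re (b f f)" if "f \<in> form_dom a" for f
      using that by (rule coercive)
    show "p f = sqrt (Re (b f f))" for f by (simp add: p_def)
  next
    fix u :: "nat \<Rightarrow> 'a"
    assume u: "\<And>n. u n \<in> form_dom a" and C: "\<And>e. e > 0 \<Longrightarrow> \<exists>N::nat. \<forall>m\<ge>N. \<forall>n\<ge>N. p (u m - u n) < e"
    have um: "u m - u n \<in> form_dom a" for m n using u sesqui_diff_mem[OF s] by blast
    have "Cauchy u"
      unfolding Cauchy_def dist_norm using C normp[OF um] by (meson le_less_trans)
    then obtain f where f: "u \<longlonglongrightarrow> f" using Cauchy_convergent convergent_def by blast
    have "form_converges a u f"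
      unfolding form_converges_def
    proof (intro conjI allI impI u f)
      fix e :: real assume e: "e > 0"
      have C1: "C > 0" using tan by (simp add: C_def c_def)
      obtain N where N: "\<And>m n. m \<ge> N \<Longrightarrow> n \<ge> N \<Longrightarrow> p (u m - u n) < sqrt (e / C)"
        using C[of "sqrt (e / C)"] e C1 by auto
      have "cmod (form_app a (u n - u m) (u n - u m)) < e" if "n \<ge> N" "m \<ge> N" for m n
      proof -
        have "(p (u n - u m))\<^sup>2 < (sqrt (e / C))\<^sup>2"
          using N[OF that] normp[OF um, of n m] norm_ge_zero[of "u n - u m"] by (intro power_strict_mono) linarith+
        then have "C * (p (u n - u m))\<^sup>2 < e" using e C1 by (simp add: field_simps)
        then show ?thesis using bound[OF um, of n m] by linarith
      qed
      then show "\<exists>N. \<forall>n\<ge>N. \<forall>m\<ge>N. cmod (form_app a (u n - u m) (u n - u m)) < e" by blast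
    qed
    then have fD: "f \<in> form_dom a" and lim: "(\<lambda>n. form_app a (u n - f) (u n - f)) \<longlonglongrightarrow> 0"
      using assms by (auto simp: closed_sectorial_form_def)
    have "(\<lambda>n. norm (u n - f)) \<longlonglongrightarrow> 0" using f by (simp add: LIM_zero tendsto_norm_zero)
    then have "(\<lambda>n. sqrt (Re (form_app a (u n - f) (u n - f)) + c * (norm (u n - f))\<^sup>2)) \<longlonglongrightarrow> sqrt (Re 0 + c * 0\<^sup>2)"
      using lim by (intro tendsto_intros)
    then have "(\<lambda>n. p (u n - f)) \<longlonglongrightarrow> 0" by (simp add: p_def Re_b)
    then show "\<exists>x\<in>form_dom a. (\<lambda>n. p (u n - x)) \<longlonglongrightarrow> 0" using fD by blast
  qed
  then have "closed_form_norm (form_dom a) p (form_app a) c C"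
    by (intro closed_form_norm.intro closed_form_norm_axioms.intro s bound)
       (use psq Re_b tan in \<open>auto simp: c_def C_def\<close>)
  then show ?thesis by blast
qed

text \<open>A core is defined through minimality among closed extensions. The form on the
  \<open>p\<close>-closure \<open>E\<close> of \<open>D\<close> is a closed extension of its
  restriction to \<open>D\<close>, so minimality forces \<open>E\<close> to be the whole
  domain.\<close>

lemma form_core_dense:
  assumes core: "form_core a D" and "closed_form_norm (form_dom a) p (form_app a) c C"
    and f: "f \<in> form_dom a" and e: "e > 0"
  shows "\<exists>g\<in>D. p (f - g) < e"
proof -
  interpret closed_form_norm "form_dom a" p "form_app a" c C by fact
  have D: "csubspace D" "D \<subseteq> form_dom a" and a: "closed_sectorial_form a"
    and min: "\<And>b. closed_sectorial_form b \<Longrightarrow> form_extends b (form_restrict a D) \<Longrightarrow> form_extends b a"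
    using core by (simp_all add: form_core_def is_form_closure_def)
  define E where "E = {f \<in> form_dom a. \<forall>e>0. \<exists>g\<in>D. p (f - g) < e}"
  have DE: "D \<subseteq> E"
  proof
    fix g assume g: "g \<in> D"
    then have "p (g - g) < e" if "e > 0" for e using that by simp
    then show "g \<in> E" using g D unfolding E_def by blast
  qed
  define b where "b = form_restrict a E"
  have dom_b: "form_dom b = E" and app_b: "form_app b = form_app a"
    by (auto simp: b_def form_restrict_def E_def)
  have "csubspace E"
    unfolding csubspace_def
  proof (intro conjI ballI allI)
    show "0 \<in> E" using DE D by (auto simp: csubspace_def)
    show "x + y \<in> E" if xyE: "x \<in> E" "y \<in> E" for x y
      unfolding E_def
    proof (intro CollectI conjI allI impI)
      have xy: "x \<in> form_dom a" "y \<in> form_dom a" using xyE by (auto simp: E_def)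
      then show "x + y \<in> form_dom a" by (rule add_mem)
      fix e :: real assume "e > 0"
      then have "e / 2 > 0" by simp
      then obtain g h where gh: "g \<in> D" "p (x - g) < e / 2" "h \<in> D" "p (y - h) < e / 2"
        using xyE unfolding E_def by blast
      have "p ((x - g) + (y - h)) \<le> p (x - g) + p (y - h)" using gh D xy by (intro triangle diff_mem) auto
      then have "p ((x + y) - (g + h)) < e" using gh by (simp add: algebra_simps)
      moreover have "g + h \<in> D" using gh D by (auto simp: csubspace_def)
      ultimately show "\<exists>g\<in>D. p (x + y - g) < e" by blast
    qed
    show "k *\<^sub>C x \<in> E" if xE: "x \<in> E" for k x
      unfolding E_def
    proof (intro CollectI conjI allI impI)
      have x: "x \<in> form_dom a" using xE by (auto simp: E_def)
      then show "k *\<^sub>C x \<in> form_dom a" by (rule scaleC_mem)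
      fix e :: real assume e: "e > 0"
      \<comment> \<open>The summand \<open>1\<close> covers \<open>k = 0\<close>.\<close>
      have "e / (cmod k + 1) > 0" using e norm_ge_zero[of k] by (intro divide_pos_pos) linarith+
      then obtain g where g: "g \<in> D" "p (x - g) < e / (cmod k + 1)"
        using xE unfolding E_def by blast
      have "p (k *\<^sub>C x - k *\<^sub>C g) = cmod k * p (x - g)"
        using x g D by (auto simp: scaleC diff_mem simp flip: scaleC_diff_right)
      also have "\<dots> \<le> (cmod k + 1) * p (x - g)"
        using nonneg[OF diff_mem[of x g]] x g D by (intro mult_right_mono) auto
      also have "\<dots> < e" using g norm_ge_zero[of k] by (simp add: field_simps add_nonneg_pos)
      finally show "\<exists>g\<in>D. p (k *\<^sub>C x - g) < e" using g D by (auto simp: csubspace_def)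
    qed
  qed
  then have "sesquilinear_form b"
    using sesqui unfolding sesquilinear_form_iff dom_b app_b by (auto simp: sesqui_on_def E_def)
  moreover have "num_range_form b \<subseteq> num_range_form a"
    unfolding num_range_form_def dom_b app_b by (auto simp: E_def)
  ultimately have "sectorial_form b"
    using a unfolding closed_sectorial_form_def sectorial_form_def by blast
  moreover have "g \<in> E \<and> (\<lambda>n. form_app a (u n - g) (u n - g)) \<longlonglongrightarrow> 0" if conv: "form_converges b u g" for u g
  proof -
    have u: "\<And>n. u n \<in> E" and ug: "u \<longlonglongrightarrow> g" using conv by (auto simp: form_converges_def dom_b)
    have "form_converges a u g" using conv by (auto simp: form_converges_def dom_b app_b E_def)
    then have g: "g \<in> form_dom a" and lim: "(\<lambda>n. form_app a (u n - g) (u n - g)) \<longlonglongrightarrow> 0"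
      using a by (auto simp: closed_sectorial_form_def)
    have uD: "u n \<in> form_dom a" for n using u by (auto simp: E_def)
    have plim: "(\<lambda>n. p (u n - g)) \<longlonglongrightarrow> 0" using form_tendsto_zero_iff[OF uD g ug] lim by simp
    have "g \<in> E"
      unfolding E_def
    proof (intro CollectI conjI allI impI g)
      fix e :: real assume e: "e > 0"
      then obtain n where n: "p (u n - g) < e / 2"
        using order_tendstoD(2)[OF plim, of "e/2"] by (auto simp: eventually_sequentially)
      obtain h where h: "h \<in> D" "p (u n - h) < e / 2"
        using u[of n] e half_gt_zero unfolding E_def by blast
      have "p (g - h) < e"
        using triangle_mid[OF g uD[of n], of h] commute[OF g uD[of n]] h n D by auto
      then show "\<exists>h\<in>D. p (g - h) < e" using h by blast
    qed
    then show ?thesis using lim by blast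
  qed
  ultimately have "closed_sectorial_form b"
    unfolding closed_sectorial_form_def dom_b app_b by blast
  moreover have "form_extends b (form_restrict a D)"
    using DE D by (auto simp: form_extends_def form_restrict_def dom_b app_b)
  ultimately have "form_extends b a" by (rule min)
  then show ?thesis using f e by (auto simp: form_extends_def dom_b E_def)
qed

text \<open>Since \<open>p\<close> dominates the norm, an approximant of \<open>f\<close> has norm
  close to \<open>1\<close>, and normalising it costs little in \<open>p\<close>.\<close>

lemma (in closed_form_norm) unit_dense:
  assumes E: "csubspace E" "E \<subseteq> D" and dense: "\<And>e. e > 0 \<Longrightarrow> \<exists>g\<in>E. p (f - g) < e"
    and f: "f \<in> D" "norm f = 1" and e: "e > 0"
  shows "\<exists>g\<in>E. norm g = 1 \<and> p (f - g) < e"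
proof -
  \<comment> \<open>If \<open>p (f - g) < \<eta>\<close>, the norm of \<open>g\<close> exceeds
    \<open>1/2\<close> and normalisation moves \<open>g\<close> by at most
    \<open>2 * \<eta> * (p f + 1/2)\<close>; the total is
    \<open>\<eta> * (2 * p f + 2)\<close>.\<close>
  define \<eta> where "\<eta> = min (1/2) (e / (2 * p f + 2))"
  have pf: "0 \<le> p f" using nonneg[OF f(1)] .
  have "\<eta> \<le> e / (2 * p f + 2)" by (simp add: \<eta>_def)
  moreover have "\<eta> \<le> 1/2" unfolding \<eta>_def by (rule min.cobounded1)
  moreover have "\<eta> > 0" using e pf by (simp add: \<eta>_def)
  ultimately have \<eta>: "\<eta> > 0" "\<eta> \<le> 1/2" "\<eta> * (2 * p f + 2) \<le> e"
    using pf pos_le_divide_eq[of "2 * p f + 2" \<eta> e] by auto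
  obtain g where g: "g \<in> E" "p (f - g) < \<eta>" using dense[OF \<eta>(1)] by blast
  have gD: "g \<in> D" using g E by blast
  have "\<bar>norm g - 1\<bar> \<le> norm (f - g)" using f norm_triangle_ineq3[of f g] by simp
  then have ng: "\<bar>norm g - 1\<bar> < \<eta>" using norm_le[OF diff_mem[OF f(1) gD]] g by linarith
  then have ng': "norm g > 1/2" using \<eta> by linarith
  have pg: "p g \<le> p f + 1/2"
    using triangle_diff[OF f(1) diff_mem[OF f(1) gD]] g \<eta> by simp
  define k where "k = (1 / norm g) *\<^sub>R g"
  have k: "k \<in> E" "norm k = 1"
    using csubspace_imp_subspace[OF E(1)] g ng' by (auto simp: k_def subspace_scale)
  have "g - k = (1 - 1 / norm g) *\<^sub>R g" by (simp add: k_def algebra_simps)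
  then have "p (g - k) = \<bar>1 - 1 / norm g\<bar> * p g" using gD by (simp add: scale)
  also have "\<bar>1 - 1 / norm g\<bar> = \<bar>norm g - 1\<bar> / norm g"
  proof -
    have "g \<noteq> 0" using ng' by auto
    then have "1 - 1 / norm g = (norm g - 1) / norm g" by (simp add: diff_divide_distrib)
    then show ?thesis by (simp add: abs_divide)
  qed
  also have "\<bar>norm g - 1\<bar> / norm g \<le> 2 * \<eta>"
  proof -
    have "2 * \<eta> * (1/2) \<le> 2 * \<eta> * norm g" using ng' \<eta> by (intro mult_left_mono) auto
    then have "\<bar>norm g - 1\<bar> \<le> 2 * \<eta> * norm g" using ng by linarith
    moreover have "norm g > 0" using ng' by linarith
    ultimately show ?thesis by (simp add: pos_divide_le_eq)
  qed
  then have "\<bar>norm g - 1\<bar> / norm g * p g \<le> 2 * \<eta> * (p f + 1/2)"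
    using pg \<eta> nonneg[OF gD] by (intro mult_mono) auto
  finally have "p (f - k) < \<eta> + 2 * \<eta> * (p f + 1/2)"
    using triangle_mid[OF f(1) gD, of k] k E g by fastforce
  also have "\<dots> = \<eta> * (2 * p f + 2)" by (simp add: algebra_simps)
  finally show ?thesis using \<eta>(3) k by (intro bexI[of _ k]) auto
qed

text \<open>A substitute for weak compactness: elements of \<open>S\<close> of almost minimal norm distance to \<open>h\<close> among those
  with \<open>\<parallel>g - h\<parallel> \<le> 1/N\<close> form a Cauchy sequence for \<open>p\<close>, by the parallelogram law.\<close>

lemma (in closed_form_norm) convex_bounded_dense:
  assumes S: "convex S" "S \<subseteq> D" and h: "h \<in> D"
    and u: "\<And>n::nat. u n \<in> S" "\<And>n. p (u n - h) \<le> B" "u \<longlonglongrightarrow> h" and e: "e > 0"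
  shows "\<exists>g\<in>S. p (h - g) < e"
proof -
  define T where "T N = {g\<in>S. norm (g - h) \<le> 1 / real (Suc N)}" for N
  define Q where "Q N = (\<lambda>g. (p (g - h))\<^sup>2) ` T N" for N
  \<comment> \<open>\<open>\<alpha>\<close> increases as \<open>T N\<close> shrinks and is bounded
    because \<open>u\<close> enters every \<open>T N\<close>; so it converges.\<close>
  define \<alpha> where "\<alpha> N = Inf (Q N)" for N
  have TS: "T N \<subseteq> S" for N by (auto simp: T_def)
  have T_mono: "T m \<subseteq> T N" if "N \<le> m" for N m
  proof -
    have "1 / real (Suc m) \<le> 1 / real (Suc N)" using that by (simp add: frac_le)
    then show ?thesis by (auto simp: T_def)
  qed
  have uT: "\<exists>n. u n \<in> T N" for N
  proof -
    have "1 / real (Suc N) > 0" by simp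
    then obtain n where "dist (u n) h < 1 / real (Suc N)" using u(3) unfolding lim_sequentially by blast
    then show ?thesis using u(1) by (auto simp: T_def dist_norm intro!: exI[of _ n])
  qed
  have bdd: "bdd_below (Q N)" for N by (auto simp: Q_def intro!: bdd_belowI[of _ 0])
  have ne: "Q N \<noteq> {}" for N using uT[of N] by (auto simp: Q_def)
  have \<alpha>_le: "\<alpha> N \<le> (p (g - h))\<^sup>2" if "g \<in> T N" for g N
    unfolding \<alpha>_def using that bdd by (intro cInf_lower) (auto simp: Q_def)
  have "\<alpha> N \<le> \<alpha> m" if "N \<le> m" for N m
    unfolding \<alpha>_def using T_mono[OF that] by (intro cInf_superset_mono ne bdd) (auto simp: Q_def)
  then have inc: "incseq \<alpha>" by (simp add: incseq_def)
  have "\<alpha> N \<le> B\<^sup>2" for N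
  proof -
    obtain n where n: "u n \<in> T N" using uT by blast
    have "0 \<le> p (u n - h)" using u S h by (intro nonneg diff_mem) auto
    then have "(p (u n - h))\<^sup>2 \<le> B\<^sup>2" using u(2)[of n] by (intro power_mono) auto
    then show ?thesis using \<alpha>_le[OF n] by linarith
  qed
  then have "Cauchy \<alpha>"
    using incseq_convergent[OF inc, of "B\<^sup>2"] by (metis LIMSEQ_imp_Cauchy)
  have "\<exists>g\<in>T N. (p (g - h))\<^sup>2 < \<alpha> N + 1 / real (Suc N)" for N
  proof -
    have "Inf (Q N) < \<alpha> N + 1 / real (Suc N)" by (simp add: \<alpha>_def)
    then obtain v where "v \<in> Q N" "v < \<alpha> N + 1 / real (Suc N)"
      using cInf_less_iff[OF ne bdd] by blast
    then show ?thesis by (auto simp: Q_def)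
  qed
  then obtain x where x: "\<And>N. x N \<in> T N" "\<And>N. (p (x N - h))\<^sup>2 < \<alpha> N + 1 / real (Suc N)" by metis
  have xS: "x N \<in> S" and xD: "x N \<in> D" for N using x(1)[of N] TS[of N] S by auto
  have diff: "(p (x N - x m))\<^sup>2 \<le> 2 * (\<alpha> m - \<alpha> N) + 4 / real (Suc N)" if "N \<le> m" for N m
  proof -
    \<comment> \<open>The midpoint lies in \<open>T N\<close>, so the parallelogram law subtracts at
      least \<open>4 * \<alpha> N\<close> from a sum that is barely larger once
      \<open>\<alpha> m\<close> is close to \<open>\<alpha> N\<close>.\<close>
    define y where "y = (1/2) *\<^sub>R x N + (1/2) *\<^sub>R x m"
    have "x m \<in> T N" using x(1)[of m] T_mono[OF that] by blast
    have yS: "y \<in> S" using S(1) xS unfolding y_def convex_def by force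
    have yh: "2 *\<^sub>R (y - h) = (x N - h) + (x m - h)"
      by (simp add: y_def algebra_simps scaleR_2)
    have "2 * norm (y - h) \<le> norm (x N - h) + norm (x m - h)"
      using norm_triangle_ineq[of "x N - h" "x m - h"] unfolding yh[symmetric] by simp
    also have "\<dots> \<le> 2 * (1 / real (Suc N))"
      using x(1)[of N] \<open>x m \<in> T N\<close> by (simp add: T_def)
    finally have "y \<in> T N" using yS by (simp add: T_def)
    then have "4 * \<alpha> N \<le> 4 * (p (y - h))\<^sup>2" using \<alpha>_le by simp
    also have "\<dots> = (p (2 *\<^sub>R (y - h)))\<^sup>2"
      using yS S h by (subst scale) (auto intro: diff_mem simp: power_mult_distrib)
    finally have 1: "4 * \<alpha> N \<le> (p ((x N - h) + (x m - h)))\<^sup>2" unfolding yh .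
    have "1 / real (Suc m) \<le> 1 / real (Suc N)" using that by (simp add: frac_le)
    then show ?thesis
      using 1 parallelogram[of "x N - h" "x m - h"] x(2)[of N] x(2)[of m] xD h by (simp add: diff_mem)
  qed
  have "\<exists>y\<in>D. (\<lambda>n. p (x n - y)) \<longlonglongrightarrow> 0"
  proof (rule complete[OF xD])
    fix e :: real assume e: "e > 0"
    \<comment> \<open>The two contributions stay below \<open>2 * \<epsilon>\<close> and
      \<open>4 * \<epsilon>\<close>, hence together below \<open>8 * \<epsilon>\<close>, the square
      of \<open>e\<close>.\<close>
    define \<epsilon> where "\<epsilon> = e\<^sup>2 / 8"
    have "\<epsilon> > 0" using e by (simp add: \<epsilon>_def)
    obtain N1 where N1: "\<And>m n. m \<ge> N1 \<Longrightarrow> n \<ge> N1 \<Longrightarrow> \<bar>\<alpha> m - \<alpha> n\<bar> < \<epsilon>"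
      using \<open>Cauchy \<alpha>\<close> \<open>\<epsilon> > 0\<close> unfolding Cauchy_def dist_real_def by meson
    obtain N2 where N2: "1 / real (Suc N2) < \<epsilon>" using \<open>\<epsilon> > 0\<close> nat_approx_posE by metis
    have *: "p (x N - x m) < e" if "max N1 N2 \<le> N" "N \<le> m" for N m
    proof -
      have "1 / real (Suc N) \<le> 1 / real (Suc N2)" using that by (simp add: frac_le)
      then have "(p (x N - x m))\<^sup>2 < 8 * \<epsilon>"
        using diff[OF that(2)] N1[of m N] N2 that by simp
      then have "(p (x N - x m))\<^sup>2 < e\<^sup>2" by (simp add: \<epsilon>_def)
      then show ?thesis by (rule power2_less_imp_less) (use e in simp)
    qed
    have "p (x m - x n) < e" if "max N1 N2 \<le> n" "max N1 N2 \<le> m" for m n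
      using *[of m n] *[of n m] that commute[OF xD xD, of m n] by (cases "m \<le> n") auto
    then show "\<exists>N. \<forall>m\<ge>N. \<forall>n\<ge>N. p (x m - x n) < e" by blast
  qed
  then obtain y where y: "y \<in> D" "(\<lambda>n. p (x n - y)) \<longlonglongrightarrow> 0" by blast
  have "x \<longlonglongrightarrow> y" using limit_norm[OF xD y] .
  moreover have "x \<longlonglongrightarrow> h"
  proof (rule LIM_zero_cancel, rule Lim_null_comparison)
    show "\<forall>\<^sub>F n in sequentially. norm (x n - h) \<le> 1 / real (Suc n)"
      using x(1) by (auto simp: T_def)
    show "(\<lambda>n. 1 / real (Suc n)) \<longlonglongrightarrow> 0" using LIMSEQ_inverse_real_of_nat by (simp add: inverse_eq_divide)
  qed
  ultimately have "y = h" by (rule LIMSEQ_unique)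
  then obtain n where "p (x n - h) < e"
    using order_tendstoD(2)[OF y(2) e] by (auto simp: eventually_sequentially)
  then show ?thesis using xS[of n] commute[OF h xD, of n] by (auto intro!: bexI[of _ "x n"])
qed

text \<open>The approximants \<open>f n\<close> are the inverse of \<open>A + s n\<close> applied to
  \<open>s n\<close> times \<open>h\<close>. Testing their equation with \<open>f n - h\<close>
  gives convergence to \<open>h\<close> in norm but only boundedness in \<open>p\<close>;
  \<open>convex_bounded_dense\<close> makes density in \<open>p\<close> out of this.\<close>

lemma associated_op_dom_dense:
  assumes A: "associated_op a A" and "closed_form_norm (form_dom a) p (form_app a) c C"
    and h: "h \<in> form_dom a" and e: "e > 0"
  shows "\<exists>g\<in>op_dom A. p (h - g) < e"
proof -
  interpret closed_form_norm "form_dom a" p "form_app a" c C by fact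
  have mA: "m_sectorial A" and dom: "op_dom A \<subseteq> form_dom a"
    and app: "\<And>f g. f \<in> op_dom A \<Longrightarrow> g \<in> form_dom a \<Longrightarrow> form_app a f g = cinner (op_app A f) g"
    using A by (auto simp: associated_op_def)
  have lin: "linear_op A" using mA by (rule m_sectorial_imp_linear_op)
  obtain \<gamma> where \<gamma>: "{z. Re z < \<gamma>} \<subseteq> resolvent_set A" using mA by (rule m_sectorialE)
  \<comment> \<open>Large enough for \<open>- s n\<close> to lie left of \<open>\<gamma>\<close> and
    for \<open>s n - c\<close> to grow like \<open>n\<close>.\<close>
  define s where "s n = \<bar>\<gamma>\<bar> + c + 1 + real n" for n :: nat
  have s: "s n > 0" for n using c_nonneg by (simp add: s_def)
  have "\<exists>f\<in>op_dom A. op_app A f - complex_of_real (- s n) *\<^sub>C f = complex_of_real (s n) *\<^sub>C h" for n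
  proof -
    have "complex_of_real (- s n) \<in> resolvent_set A" using \<gamma> c_nonneg by (auto simp: s_def)
    then have "bij_betw (\<lambda>f. op_app A f - complex_of_real (- s n) *\<^sub>C f) (op_dom A) UNIV"
      unfolding resolvent_set_def by blast
    then have "complex_of_real (s n) *\<^sub>C h \<in> (\<lambda>f. op_app A f - complex_of_real (- s n) *\<^sub>C f) ` op_dom A"
      by (simp add: bij_betw_def)
    then show ?thesis by (metis (no_types, lifting) imageE)
  qed
  then obtain f where f: "\<And>n. f n \<in> op_dom A"
    "\<And>n. op_app A (f n) - complex_of_real (- s n) *\<^sub>C f n = complex_of_real (s n) *\<^sub>C h" by metis
  \<comment> \<open>By \<open>sesqui_bound\<close>, the form at the pair \<open>h\<close>,
    \<open>e\<close> is at most \<open>B * p e\<close> in modulus.\<close>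
  define B where "B = 4 * C * p h"
  have B0: "B \<ge> 0" using C_nonneg nonneg[OF h] by (simp add: B_def)
  have fD: "f n \<in> form_dom a" for n using f dom by blast
  have eD: "f n - h \<in> form_dom a" for n using fD h by (rule diff_mem)
  have key: "(p (f n - h))\<^sup>2 + (s n - c) * (norm (f n - h))\<^sup>2 \<le> B * p (f n - h)" for n
  proof -
    let ?e = "f n - h"
    have "op_app A (f n) = - (complex_of_real (s n) *\<^sub>C ?e)"
      using f(2)[of n] by (simp add: scaleC_minus_left scaleC_diff_right algebra_simps eq_neg_iff_add_eq_0)
    then have "form_app a (f n) ?e = - complex_of_real (s n * (norm ?e)\<^sup>2)"
      using app[OF f(1) eD] by (simp add: cinner_minus_left cinner_scaleC_left cinner_self)
    then have "Re (form_app a ?e ?e) = - (s n * (norm ?e)\<^sup>2) - Re (form_app a h ?e)"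
      using sesqui_diff_left[OF sesqui fD h eD, of n n] by (simp del: of_real_mult of_real_power)
    moreover have "- Re (form_app a h ?e) \<le> B * p ?e"
      using sesqui_bound[OF sesqui bound h eD, of n] complex_Re_le_cmod[of "- form_app a h ?e"] by (simp add: B_def)
    ultimately show ?thesis using sq[OF eD, of n] by (simp add: algebra_simps)
  qed
  have sc: "real (Suc n) \<le> s n - c" for n by (simp add: s_def)
  have pB: "p (f n - h) \<le> B" for n
  proof (rule ccontr)
    assume "\<not> p (f n - h) \<le> B"
    then have "B * p (f n - h) < (p (f n - h))\<^sup>2" using B0 by (simp add: power2_eq_square)
    moreover have "0 \<le> (s n - c) * (norm (f n - h))\<^sup>2" using sc[of n] by simp
    ultimately show False using key[of n] by linarith
  qed
  have nB: "(norm (f n - h))\<^sup>2 \<le> B\<^sup>2 * (1 / real (Suc n))" for n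
  proof -
    have "real (Suc n) * (norm (f n - h))\<^sup>2 \<le> (s n - c) * (norm (f n - h))\<^sup>2"
      using sc by (intro mult_right_mono) auto
    moreover have "B * p (f n - h) \<le> B\<^sup>2" using pB B0 by (simp add: power2_eq_square mult_left_mono)
    ultimately have "real (Suc n) * (norm (f n - h))\<^sup>2 \<le> B\<^sup>2"
      using key[of n] zero_le_power2[of "p (f n - h)"] by linarith
    then show ?thesis by (simp add: pos_le_divide_eq mult.commute)
  qed
  have "(\<lambda>n. B\<^sup>2 * (1 / real (Suc n))) \<longlonglongrightarrow> B\<^sup>2 * 0"
    using LIMSEQ_inverse_real_of_nat by (intro tendsto_mult tendsto_const) (simp add: inverse_eq_divide)
  then have "(\<lambda>n. B\<^sup>2 * (1 / real (Suc n))) \<longlonglongrightarrow> 0" by simp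
  then have "(\<lambda>n. (norm (f n - h))\<^sup>2) \<longlonglongrightarrow> 0"
    by (rule real_tendsto_sandwich[rotated 3, OF _ _ _ tendsto_const]) (use nB in simp_all)
  then have "(\<lambda>n. norm (f n - h)) \<longlonglongrightarrow> 0"
    using tendsto_real_sqrt[of "\<lambda>n. (norm (f n - h))\<^sup>2" 0] by simp
  then have "f \<longlonglongrightarrow> h" using tendsto_norm_zero_iff LIM_zero_cancel by blast
  moreover have "convex (op_dom A)"
    using lin csubspace_imp_subspace subspace_imp_convex unfolding linear_op_def by blast
  ultimately show ?thesis by (intro convex_bounded_dense[where u = f and B = B]) (use dom h f(1) pB e in auto)
qed


section \<open>Families of type (a)\<close>

locale type_a_family =
  fixes \<Omega> :: "complex set" and t :: "complex \<Rightarrow> 'a::chilbert_space form" and D :: "'a set"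
  assumes open_\<Omega>: "open \<Omega>"
    and dom: "z \<in> \<Omega> \<Longrightarrow> form_dom (t z) = D"
    and closed_form: "z \<in> \<Omega> \<Longrightarrow> closed_sectorial_form (t z)"
    and holo: "f \<in> D \<Longrightarrow> (\<lambda>z. form_app (t z) f f) holomorphic_on \<Omega>"
begin

definition is_norm_at :: "complex \<Rightarrow> ('a \<Rightarrow> real) \<Rightarrow> real \<Rightarrow> real \<Rightarrow> bool"
  where "is_norm_at z p c C \<longleftrightarrow> closed_form_norm D p (form_app (t z)) c C"

lemma ex_norm_at: "z \<in> \<Omega> \<Longrightarrow> \<exists>p c C. is_norm_at z p c C"
  using closed_sectorial_form_norm[OF closed_form] dom by (simp add: is_norm_at_def)

lemma sesqui_at: "z \<in> \<Omega> \<Longrightarrow> sesqui_on D (form_app (t z))"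
  using closed_form[of z] dom[of z]
  by (simp add: closed_sectorial_form_def sectorial_form_def sesquilinear_form_iff)

text \<open>The uniform boundedness principle for the quadratic forms \<open>t(z)\<close>, with one
  complete norm for all \<open>z\<close>. Pointwise bounds come from continuity in \<open>z\<close>
  on \<open>K\<close>. The sets \<open>E n\<close> are closed because each single
  \<open>t(z)\<close> is continuous in \<open>p\<close>, which is where the equivalence of complete
  norms enters.\<close>

lemma uniform_bound:
  assumes "complete_norm_on D p" and K: "compact K" "K \<subseteq> \<Omega>"
  shows "\<exists>M\<ge>0. \<forall>z\<in>K. \<forall>f\<in>D. cmod (form_app (t z) f f) \<le> M * (p f)\<^sup>2"
proof -
  interpret complete_norm_on D p by fact
  have individual: "\<exists>N. \<forall>f\<in>D. cmod (form_app (t z) f f) \<le> N * (p f)\<^sup>2" if z: "z \<in> K" for z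
  proof -
    obtain q c C where "is_norm_at z q c C" using ex_norm_at z K by blast
    then interpret q: closed_form_norm D q "form_app (t z)" c C by (simp add: is_norm_at_def)
    obtain M where M: "M \<ge> 0" "\<And>f. f \<in> D \<Longrightarrow> q f \<le> M * p f"
      using complete_norms_comparable[OF \<open>complete_norm_on D p\<close> q.complete_norm_on_axioms] by blast
    have "cmod (form_app (t z) f f) \<le> (C * M\<^sup>2) * (p f)\<^sup>2" if f: "f \<in> D" for f
    proof -
      have "C * (q f)\<^sup>2 \<le> C * (M * p f)\<^sup>2"
        using M(2)[OF f] q.nonneg[OF f] q.C_nonneg by (intro mult_left_mono power_mono) auto
      then show ?thesis using q.bound[OF f] by (simp add: power_mult_distrib mult.assoc)
    qed
    then show ?thesis by blast
  qed
  define E where "E n = {f\<in>D. \<forall>z\<in>K. cmod (form_app (t z) f f) \<le> real n}" for n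
  obtain n x0 r where x0: "x0 \<in> D" "0 < r" "\<And>y. y \<in> D \<Longrightarrow> p (y - x0) < r \<Longrightarrow> y \<in> E n"
  proof (rule baire[of E])
    show "E n \<subseteq> D" for n by (auto simp: E_def)
    show "D \<subseteq> (\<Union>n. E n)"
    proof
      fix f assume f: "f \<in> D"
      then have "compact ((\<lambda>z. form_app (t z) f f) ` K)"
        using K holo by (intro compact_continuous_image) (meson holomorphic_on_imp_continuous_on continuous_on_subset)
      then have "bounded ((\<lambda>z. form_app (t z) f f) ` K)" by (rule compact_imp_bounded)
      then obtain B where B: "\<forall>v\<in>(\<lambda>z. form_app (t z) f f) ` K. cmod v \<le> B"
        unfolding bounded_iff by (rule exE)
      obtain n :: nat where "B \<le> real n" using real_arch_simple by blast
      then have "cmod (form_app (t z) f f) \<le> real n" if "z \<in> K" for z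
        using B that by (meson imageI order_trans)
      then have "f \<in> E n" using f by (simp add: E_def)
      then show "f \<in> (\<Union>n. E n)" by blast
    qed
    show "x \<in> E n" if u: "\<And>k. u k \<in> E n" and x: "x \<in> D" and lim: "(\<lambda>k. p (u k - x)) \<longlonglongrightarrow> 0" for n u x
      unfolding E_def
    proof (intro CollectI conjI x ballI)
      fix z assume z: "z \<in> K"
      have s: "sesqui_on D (form_app (t z))" using sesqui_at z K by blast
      obtain N where N: "\<And>f. f \<in> D \<Longrightarrow> cmod (form_app (t z) f f) \<le> N * (p f)\<^sup>2"
        using individual[OF z] by blast
      have uD: "u k \<in> D" and uE: "cmod (form_app (t z) (u k) (u k)) \<le> real n" for k
        using u[of k] z by (auto simp: E_def)
      have bd: "p (u k + x) \<le> p (u k - x) + 2 * p x" for k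
        using triangle[OF diff_mem[OF uD x] scale_mem[OF x], of k 2] scale[OF x, of 2] by (simp add: scaleR_2)
      have "cmod (form_app (t z) x x) \<le> real n + 2 * \<bar>N\<bar> * (p (u k - x) + 2 * p x) * p (u k - x)" for k
      proof -
        have "cmod (form_app (t z) (u k) (u k) - form_app (t z) x x) \<le> 2 * N * p (u k + x) * p (u k - x)"
          using sesqui_diff_bound[OF \<open>complete_norm_on D p\<close> s N uD x] .
        also have "\<dots> \<le> 2 * \<bar>N\<bar> * (p (u k - x) + 2 * p x) * p (u k - x)"
          by (rule mult_mono[OF mult_mono[OF _ bd[of k]]])
            (simp_all add: nonneg add_mem diff_mem uD x)
        finally show ?thesis
          using uE[of k] norm_triangle_ineq2[of "form_app (t z) x x" "form_app (t z) (u k) (u k)"]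
          by (simp add: norm_minus_commute)
      qed
      moreover have "(\<lambda>k. real n + 2 * \<bar>N\<bar> * (p (u k - x) + 2 * p x) * p (u k - x))
          \<longlonglongrightarrow> real n + 2 * \<bar>N\<bar> * (0 + 2 * p x) * 0"
        by (intro tendsto_intros lim)
      ultimately show "cmod (form_app (t z) x x) \<le> real n"
        by (intro tendsto_lowerbound[where F = sequentially]) (auto intro!: always_eventually)
    qed
  qed (rule that)
  have ball: "cmod (form_app (t z) y y) \<le> 2 * real n" if y: "y \<in> D" "p y < r" and z: "z \<in> K" for y z
  proof -
    have s: "sesqui_on D (form_app (t z))" using sesqui_at z K by blast
    have "x0 \<in> E n" by (rule x0(3)) (use x0(1,2) in simp_all)
    moreover have "x0 + y \<in> E n" by (rule x0(3)) (use x0(1) y add_mem in simp_all)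
    moreover have "x0 - y \<in> E n" by (rule x0(3)) (use x0(1) y diff_mem minus[of y] in simp_all)
    ultimately have bd: "cmod (form_app (t z) (x0 + y) (x0 + y)) \<le> real n" "cmod (form_app (t z) (x0 - y) (x0 - y)) \<le> real n"
      "cmod (form_app (t z) x0 x0) \<le> real n" using z by (auto simp: E_def)
    \<comment> \<open>The parallelogram identity moves the bound from the ball around
      \<open>x0\<close> to the ball around \<open>0\<close>.\<close>
    have "2 * form_app (t z) y y
        = form_app (t z) (x0 + y) (x0 + y) + form_app (t z) (x0 - y) (x0 - y) - 2 * form_app (t z) x0 x0"
      using sesqui_parallelogram[OF s x0(1) y(1)] by simp
    then have "2 * cmod (form_app (t z) y y)
        = cmod (form_app (t z) (x0 + y) (x0 + y) + form_app (t z) (x0 - y) (x0 - y) - 2 * form_app (t z) x0 x0)"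
      by (metis norm_mult norm_numeral)
    also have "\<dots> \<le> (real n + real n) + 2 * real n"
      by (intro norm_triangle_le_diff norm_triangle_le add_mono bd) (use bd in \<open>simp add: norm_mult\<close>)
    finally show ?thesis by simp
  qed
  \<comment> \<open>Rescaling \<open>f\<close> to \<open>p\<close>-norm \<open>r / 2\<close> turns
    the bound \<open>2 * n\<close> on the ball into the factor
    \<open>8 * n / r\<^sup>2\<close>.\<close>
  show ?thesis
  proof (intro exI[of _ "8 * real n / r\<^sup>2"] conjI ballI)
    fix z f assume z: "z \<in> K" and f: "f \<in> D"
    have s: "sesqui_on D (form_app (t z))" using sesqui_at z K by blast
    show "cmod (form_app (t z) f f) \<le> 8 * real n / r\<^sup>2 * (p f)\<^sup>2"
    proof (cases "f = 0")
      case True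
      then show ?thesis using sesqui_diag_zero[OF s] by simp
    next
      case False
      then have pf: "p f > 0" using f nonneg eq_zero by (metis less_eq_real_def)
      define k where "k = r / (2 * p f)"
      have k: "k > 0" using pf x0 by (simp add: k_def)
      have "p (k *\<^sub>R f) < r" using f pf x0 by (simp add: scale k_def)
      then have "cmod (form_app (t z) (k *\<^sub>R f) (k *\<^sub>R f)) \<le> 2 * real n"
        by (intro ball scale_mem f z)
      then have "k\<^sup>2 * cmod (form_app (t z) f f) \<le> 2 * real n"
        using f by (simp add: sesqui_diag_scaleR[OF s] norm_mult norm_power)
      then show ?thesis using pf x0 by (simp add: k_def power_divide power_mult_distrib field_simps)
    qed
  qed simp
qed

section \<open>Cauchy estimates and equicontinuity in the parameter\<close>

lemma deriv_bound:
  assumes h: "h holomorphic_on \<Omega>" and r: "0 < r" "cball z r \<subseteq> \<Omega>"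
    and B: "\<And>w. w \<in> cball z r \<Longrightarrow> cmod (h w) \<le> B"
  shows "cmod ((deriv ^^ k) h z) \<le> fact k * B / r ^ k"
proof (rule Cauchy_inequality[OF _ _ r(1)])
  show "h holomorphic_on ball z r" using h r by (meson ball_subset_cball holomorphic_on_subset order_trans)
  show "continuous_on (cball z r) h"
    using h r by (meson holomorphic_on_imp_continuous_on continuous_on_subset)
qed (use B in \<open>auto simp: dist_norm\<close>)

lemma local_lipschitz:
  assumes z: "z \<in> \<Omega>" and p: "complete_norm_on D p"
  shows "\<exists>r>0. \<exists>L\<ge>0. \<forall>w\<in>ball z r. \<forall>f\<in>D.
    cmod (form_app (t w) f f - form_app (t z) f f) \<le> L * cmod (w - z) * (p f)\<^sup>2"
proof -
  obtain e where e: "e > 0" "cball z e \<subseteq> \<Omega>" using open_\<Omega> z open_contains_cball by blast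
  \<comment> \<open>Half the radius, so that closed discs of radius \<open>r\<close> around points
    of \<open>ball z r\<close> stay where the bound \<open>M\<close> is valid.\<close>
  define r where "r = e / 2"
  have r: "r > 0" using e by (simp add: r_def)
  obtain M where M: "M \<ge> 0" "\<And>w f. w \<in> cball z e \<Longrightarrow> f \<in> D \<Longrightarrow> cmod (form_app (t w) f f) \<le> M * (p f)\<^sup>2"
    using uniform_bound[OF p compact_cball e(2)] by blast
  have "cmod (form_app (t w) f f - form_app (t z) f f) \<le> M / r * cmod (w - z) * (p f)\<^sup>2"
    if w: "w \<in> ball z r" and f: "f \<in> D" for w f
  proof -
    let ?h = "\<lambda>w. form_app (t w) f f"
    have sub: "cball v r \<subseteq> cball z e" if "v \<in> ball z r" for v
      using that by (auto simp: r_def cball_subset_cball_iff dist_commute)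
    have "cmod (?h w - ?h z) \<le> M * (p f)\<^sup>2 / r * cmod (w - z)"
    proof (rule field_differentiable_bound[of "ball z r" ?h "deriv ?h"])
      fix v assume v: "v \<in> ball z r"
      then have "v \<in> \<Omega>" using sub[OF v] e r by (metis centre_in_cball less_imp_le subsetD)
      then show "(?h has_field_derivative deriv ?h v) (at v within ball z r)"
        using holo[OF f] open_\<Omega> by (intro DERIV_subset[OF holomorphic_derivI]) auto
      show "cmod (deriv ?h v) \<le> M * (p f)\<^sup>2 / r"
      proof -
        have "cmod ((deriv ^^ 1) ?h v) \<le> fact 1 * (M * (p f)\<^sup>2) / r ^ 1"
          by (rule deriv_bound[OF holo[OF f] r]) (use sub[OF v] e M(2)[OF _ f] in blast)+
        then show ?thesis by simp
      qed
    qed (use w r in auto)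
    then show ?thesis by (simp add: mult_ac)
  qed
  then show ?thesis using r M(1) by (intro exI[of _ r] conjI exI[of _ "M / r"]) auto
qed

lemma norm_sq_le:
  assumes "is_norm_at z p c C" "f \<in> D" "norm f = 1"
  shows "(p f)\<^sup>2 \<le> cmod (form_app (t z) f f) + c"
  using closed_form_norm.sq[OF assms(1)[unfolded is_norm_at_def] assms(2)] assms(3)
    complex_Re_le_cmod[of "form_app (t z) f f"] by simp

text \<open>The vectors \<open>f\<close> vary with the zeros \<open>w\<close>, so the Lipschitz
  bound involves an uncontrolled \<open>p f\<close>. Replacing it by the form value gives
  \<open>m \<le> d * (m + c)\<close> with \<open>m\<close> the modulus of that value at
  \<open>z\<close>; as \<open>d\<close> is small, \<open>d * m\<close> is absorbed on the
  left.\<close>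

lemma zero_in_closure_num_range:
  assumes z: "z \<in> \<Omega>" and cl: "z \<in> closure {w\<in>\<Omega>. \<exists>f\<in>D. norm f = 1 \<and> form_app (t w) f f = 0}"
  shows "0 \<in> closure {form_app (t z) f f | f. f \<in> D \<and> norm f = 1}"
  unfolding closure_approachable
proof (intro allI impI)
  fix e :: real assume e: "e > 0"
  obtain p c C where p: "is_norm_at z p c C" using ex_norm_at[OF z] by blast
  then have cn: "complete_norm_on D p" and c: "c \<ge> 0"
    by (auto simp: is_norm_at_def closed_form_norm_def closed_form_norm_axioms_def)
  obtain r L where r: "r > 0" and L: "L \<ge> 0" and lip: "\<And>w f. w \<in> ball z r \<Longrightarrow> f \<in> D \<Longrightarrow>
      cmod (form_app (t w) f f - form_app (t z) f f) \<le> L * cmod (w - z) * (p f)\<^sup>2"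
    using local_lipschitz[OF z cn] by blast
  \<comment> \<open>\<open>1/2\<close> permits the absorption, which leaves
    \<open>m \<le> 2 * c * d\<close>; the summand \<open>1\<close> keeps the denominator positive
    for \<open>c = 0\<close>.\<close>
  define \<delta> where "\<delta> = min (1/2) (e / (2 * c + 1))"
  have \<delta>: "\<delta> > 0" "\<delta> \<le> 1/2" "\<delta> \<le> e / (2 * c + 1)" using e c unfolding \<delta>_def by (simp, intro min.cobounded1, intro min.cobounded2)
  have "min r (\<delta> / (L + 1)) > 0" using \<delta> L r by simp
  then obtain w f where w: "dist w z < min r (\<delta> / (L + 1))" and f: "f \<in> D" "norm f = 1" and 0: "form_app (t w) f f = 0"
    using cl unfolding closure_approachable by blast
  define d where "d = L * cmod (w - z)"
  define m where "m = cmod (form_app (t z) f f)"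
  have "L * cmod (w - z) \<le> (L + 1) * cmod (w - z)" by (intro mult_right_mono) auto
  also have "\<dots> < \<delta>" using w L by (simp add: dist_norm field_simps)
  finally have d: "0 \<le> d" "d < \<delta>" using L by (auto simp: d_def)
  have "m \<le> d * (p f)\<^sup>2"
    using lip[of w f] w f 0 by (simp add: d_def m_def dist_commute)
  also have "\<dots> \<le> d * (m + c)" using norm_sq_le[OF p f] d by (intro mult_left_mono) (auto simp: m_def)
  finally have "m \<le> d * m + d * c" by (simp add: algebra_simps)
  moreover have "d * m \<le> 1/2 * m" using d \<delta> by (intro mult_right_mono) (auto simp: m_def)
  ultimately have "m \<le> 2 * (d * c)" by linarith
  also have "\<dots> = 2 * c * d" by simp
  also have "\<dots> \<le> 2 * c * \<delta>" using d c by (intro mult_left_mono) auto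
  also have "\<dots> < (2 * c + 1) * \<delta>" using \<delta> by simp
  also have "\<dots> \<le> e" using \<delta>(3) c by (simp add: field_simps)
  finally show "\<exists>y\<in>{form_app (t z) f f | f. f \<in> D \<and> norm f = 1}. dist y 0 < e"
    using f by (intro bexI[of _ "form_app (t z) f f"]) (auto simp: m_def)
qed

text \<open>Carries the hypothesis on the derivative from the core to all of \<open>D\<close>. The
  difference of the form values at \<open>f\<close> and \<open>g\<close> is first bounded on a disc
  around \<open>\<mu>\<close> by a multiple of \<open>p (f - g)\<close> and then differentiated by
  Cauchy's estimate.\<close>

lemma deriv_lower_bound:
  assumes \<mu>: "\<mu> \<in> \<Omega>" and core: "form_core (t \<mu>) E"
    and 0: "0 \<notin> closure (num_range_form (form_restrict (form_deriv t k \<mu>) E))"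
  shows "\<exists>\<delta>>0. \<forall>f\<in>D. norm f = 1 \<longrightarrow> \<delta> \<le> cmod ((deriv ^^ k) (\<lambda>w. form_app (t w) f f) \<mu>)"
proof -
  let ?s = "\<lambda>f. (deriv ^^ k) (\<lambda>w. form_app (t w) f f) \<mu>"
  obtain p c C where p: "is_norm_at \<mu> p c C" using ex_norm_at[OF \<mu>] by blast
  then interpret closed_form_norm D p "form_app (t \<mu>)" c C by (simp add: is_norm_at_def)
  have E: "csubspace E" "E \<subseteq> D" using core dom[OF \<mu>] by (auto simp: form_core_def)
  have dense: "\<exists>g\<in>E. p (f - g) < e" if "f \<in> D" "e > 0" for f e
    using form_core_dense[OF core _ _ that(2), of p c C f] p that dom[OF \<mu>] by (simp add: is_norm_at_def)
  obtain \<delta> where \<delta>: "\<delta> > 0" and lower: "\<And>g. g \<in> E \<Longrightarrow> norm g = 1 \<Longrightarrow> \<delta> \<le> cmod (?s g)"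
  proof -
    have "num_range_form (form_restrict (form_deriv t k \<mu>) E) = {?s g | g. g \<in> E \<and> norm g = 1}"
      using E dom[OF \<mu>] by (auto simp: num_range_form_def form_restrict_def form_deriv_def)
    then obtain \<delta> where "\<delta> > 0" "\<And>v. v \<in> {?s g | g. g \<in> E \<and> norm g = 1} \<Longrightarrow> \<not> dist v 0 < \<delta>"
      using 0 unfolding closure_approachable by metis
    then show thesis using that[of \<delta>] by (force simp: not_less)
  qed
  obtain r where r: "r > 0" "cball \<mu> r \<subseteq> \<Omega>" using open_\<Omega> \<mu> open_contains_cball by blast
  obtain M where M: "M \<ge> 0" "\<And>w f. w \<in> cball \<mu> r \<Longrightarrow> f \<in> D \<Longrightarrow> cmod (form_app (t w) f f) \<le> M * (p f)\<^sup>2"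
    using uniform_bound[OF complete_norm_on_axioms compact_cball r(2)] by blast
  have "\<delta> / 2 \<le> cmod (?s f)" if f: "f \<in> D" "norm f = 1" for f
  proof -
    \<comment> \<open>Cauchy's constant for the difference; \<open>2 * p f + 1\<close> bounds
      \<open>p (f + g)\<close> because \<open>f + g\<close> is \<open>2 f - (f - g)\<close> and
      \<open>\<eta> \<le> 1\<close>. The choice of \<open>\<eta>\<close> makes the error at most
      \<open>\<delta> / 2\<close>.\<close>
    define A where "A = fact k * (2 * M * (2 * p f + 1)) / r ^ k"
    have A: "A \<ge> 0" using M nonneg[OF f(1)] r by (simp add: A_def)
    define \<eta> where "\<eta> = min 1 (\<delta> / (2 * (A + 1)))"
    have \<eta>: "\<eta> > 0" "\<eta> \<le> 1" "\<eta> \<le> \<delta> / (2 * (A + 1))"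
      using \<delta> A unfolding \<eta>_def by (simp, intro min.cobounded1, intro min.cobounded2)
    obtain g where g: "g \<in> E" "norm g = 1" "p (f - g) < \<eta>"
      using unit_dense[OF E dense[OF f(1)] f \<eta>(1)] by blast
    have gD: "g \<in> D" using g E by blast
    have pg: "p (f + g) \<le> 2 * p f + 1"
      using triangle_diff[OF scale_mem[OF f(1), of 2] diff_mem[OF f(1) gD]] scale[OF f(1), of 2] g \<eta>
      by (simp add: scaleR_2 algebra_simps)
    have "cmod (form_app (t w) f f - form_app (t w) g g) \<le> (2 * M * (2 * p f + 1)) * p (f - g)"
      if w: "w \<in> cball \<mu> r" for w
    proof -
      have "cmod (form_app (t w) f f - form_app (t w) g g) \<le> 2 * M * p (f + g) * p (f - g)"
        by (rule sesqui_diff_bound[where b = "form_app (t w)", OF complete_norm_on_axioms _ _ f(1) gD])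
          (use M(2)[OF w] sesqui_at[of w] w r in \<open>auto simp: subset_iff\<close>)
      also have "\<dots> \<le> 2 * M * (2 * p f + 1) * p (f - g)"
        using pg M nonneg[OF diff_mem[OF f(1) gD]] by (intro mult_right_mono mult_left_mono) auto
      finally show ?thesis .
    qed
    then have "cmod ((deriv ^^ k) (\<lambda>w. form_app (t w) f f - form_app (t w) g g) \<mu>)
        \<le> fact k * ((2 * M * (2 * p f + 1)) * p (f - g)) / r ^ k"
      using f gD holo by (intro deriv_bound r holomorphic_on_diff) auto
    also have "(deriv ^^ k) (\<lambda>w. form_app (t w) f f - form_app (t w) g g) \<mu> = ?s f - ?s g"
      using holo[OF f(1)] holo[OF gD] open_\<Omega> \<mu> by (rule higher_deriv_diff)
    also have "fact k * ((2 * M * (2 * p f + 1)) * p (f - g)) / r ^ k = A * p (f - g)"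
      by (simp add: A_def)
    also have "\<dots> \<le> A * (\<delta> / (2 * (A + 1)))" using g \<eta> A by (intro mult_left_mono) auto
    also have "\<dots> \<le> \<delta> / 2" using A \<delta> by (simp add: field_simps)
    finally show ?thesis
      using lower[OF g(1,2)] norm_triangle_ineq2[of "?s g" "?s f"] by (simp add: norm_minus_commute)
  qed
  then show ?thesis using \<delta> by (intro exI[of _ "\<delta> / 2"]) auto
qed

text \<open>If \<open>\<lambda>\<close> were not in the closure, Montel's and Hurwitz' theorems would yield a subsequence of the functions
  \<open>t(\<cdot>)[f\<^sub>n]\<close> converging to \<open>0\<close> locally uniformly on \<open>\<Omega>\<close>, and so would their \<open>k\<close>-th derivatives at \<open>\<mu>\<close>.\<close>

lemma in_closure_zeros:
  assumes conn: "connected \<Omega>" and \<mu>: "\<mu> \<in> \<Omega>" and lam: "l \<in> \<Omega>"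
    and \<delta>: "\<delta> > 0" "\<And>f. f \<in> D \<Longrightarrow> norm f = 1 \<Longrightarrow> \<delta> \<le> cmod ((deriv ^^ k) (\<lambda>w. form_app (t w) f f) \<mu>)"
    and E: "E \<subseteq> D" and 0: "0 \<in> closure {form_app (t l) f f | f. f \<in> E \<and> norm f = 1}"
  shows "l \<in> closure {w\<in>\<Omega>. \<exists>f\<in>E. norm f = 1 \<and> form_app (t w) f f = 0}"
proof (rule ccontr)
  assume "l \<notin> closure {w\<in>\<Omega>. \<exists>f\<in>E. norm f = 1 \<and> form_app (t w) f f = 0}"
  then obtain r0 where r0: "r0 > 0"
    "\<And>w. w \<in> \<Omega> \<Longrightarrow> \<exists>f\<in>E. norm f = 1 \<and> form_app (t w) f f = 0 \<Longrightarrow> \<not> dist w l < r0"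
    unfolding closure_approachable by blast
  obtain r1 where r1: "r1 > 0" "ball l r1 \<subseteq> \<Omega>" using open_\<Omega> lam openE by blast
  \<comment> \<open>On this disc all functions in question are defined and have no zeros.\<close>
  define S where "S = ball l (min r0 r1)"
  have S: "open S" "connected S" "S \<subseteq> \<Omega>" "l \<in> S" using r0 r1 by (auto simp: S_def)
  obtain p c C where p: "is_norm_at l p c C" using ex_norm_at[OF lam] by blast
  then have cn: "complete_norm_on D p" by (auto simp: is_norm_at_def closed_form_norm_def)
  have "\<exists>f. f \<in> E \<and> norm f = 1 \<and> cmod (form_app (t l) f f) < 1 / real (Suc n)" for n
  proof -
    have "1 / real (Suc n) > 0" by simp
    then obtain y where "y \<in> {form_app (t l) f f | f. f \<in> E \<and> norm f = 1}" "dist y 0 < 1 / real (Suc n)"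
      using 0 unfolding closure_approachable by blast
    then show ?thesis by auto
  qed
  then obtain f where f: "\<And>n. f n \<in> E" "\<And>n. norm (f n) = 1"
    "\<And>n. cmod (form_app (t l) (f n) (f n)) < 1 / real (Suc n)" by metis
  have fD: "f n \<in> D" for n using f E by blast
  define \<phi> where "\<phi> n w = form_app (t w) (f n) (f n)" for n w
  have hol\<phi>: "\<phi> n holomorphic_on \<Omega>" for n unfolding \<phi>_def using holo[OF fD] .
  \<comment> \<open>Smallness at the single point \<open>l\<close> bounds the vectors in
    \<open>p\<close>, and thereby the functions on every compact subset of
    \<open>\<Omega>\<close>.\<close>
  have pf: "(p (f n))\<^sup>2 \<le> 1 + c" for n
  proof -
    have "1 / real (Suc n) \<le> 1" by simp
    then show ?thesis using norm_sq_le[OF p fD f(2), of n] f(3)[of n] by linarith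
  qed
  obtain g s where g: "g holomorphic_on \<Omega>" and s: "strict_mono (s :: nat \<Rightarrow> nat)"
    and lim: "\<And>x. x \<in> \<Omega> \<Longrightarrow> ((\<lambda>n. \<phi> (s n) x) \<longlongrightarrow> g x) sequentially"
    and ulim: "\<And>K. compact K \<Longrightarrow> K \<subseteq> \<Omega> \<Longrightarrow> uniform_limit K (\<phi> \<circ> s) g sequentially"
  proof (rule Montel[OF open_\<Omega>, of "range \<phi>" \<phi>])
    fix K assume K: "compact K" "K \<subseteq> \<Omega>"
    obtain M where M: "M \<ge> 0" "\<And>w f. w \<in> K \<Longrightarrow> f \<in> D \<Longrightarrow> cmod (form_app (t w) f f) \<le> M * (p f)\<^sup>2"
      using uniform_bound[OF cn K] by blast
    have "cmod (\<phi> n w) \<le> M * (1 + c)" if "w \<in> K" for n w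
      using M(2)[OF that fD[of n]] mult_left_mono[OF pf[of n] M(1)] unfolding \<phi>_def by linarith
    then show "\<exists>B. \<forall>h\<in>range \<phi>. \<forall>z\<in>K. cmod (h z) \<le> B" by blast
  qed (use hol\<phi> in auto)
  have "(\<lambda>n. \<phi> n l) \<longlonglongrightarrow> 0"
  proof (rule Lim_null_comparison)
    show "\<forall>\<^sub>F n in sequentially. cmod (\<phi> n l) \<le> 1 / real (Suc n)"
      unfolding \<phi>_def by (intro always_eventually allI less_imp_le f(3))
    show "(\<lambda>n. 1 / real (Suc n)) \<longlonglongrightarrow> 0" using LIMSEQ_inverse_real_of_nat by (simp add: inverse_eq_divide)
  qed
  then have "(\<lambda>n. \<phi> (s n) l) \<longlonglongrightarrow> 0" using LIMSEQ_subseq_LIMSEQ[OF _ s] by (simp add: o_def)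
  then have gl: "g l = 0" using lim[OF lam] LIMSEQ_unique by blast
  have nz: "(\<phi> \<circ> s) n w \<noteq> 0" if "w \<in> S" for n w
  proof
    assume "(\<phi> \<circ> s) n w = 0"
    then have "\<exists>f\<in>E. norm f = 1 \<and> form_app (t w) f f = 0" using f by (auto simp: \<phi>_def)
    moreover have "w \<in> \<Omega>" using that S by blast
    ultimately show False using r0(2)[of w] that by (simp add: S_def dist_commute)
  qed
  \<comment> \<open>A nonconstant limit of zero-free functions would be zero-free, but
    \<open>g l = 0\<close>.\<close>
  have "g constant_on S"
  proof (rule ccontr)
    assume "\<not> g constant_on S"
    then have "g l \<noteq> 0"
      using S nz
      by (intro Hurwitz_no_zeros[of S "\<phi> \<circ> s" g l] holomorphic_on_subset[OF g] ulim)
         (auto intro: holomorphic_on_subset[OF hol\<phi>])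
    then show False using gl by simp
  qed
  then have "g z = 0" if "z \<in> S" for z using gl S(4) that unfolding constant_on_def by metis
  then have g0: "g z = 0" if "z \<in> \<Omega>" for z
    using analytic_continuation_open[OF S(1) open_\<Omega> _ conn S(3) g holomorphic_on_const, of 0 z] S(4) that by blast
  obtain \<rho> where \<rho>: "\<rho> > 0" "cball \<mu> \<rho> \<subseteq> \<Omega>" using open_\<Omega> \<mu> open_contains_cball by blast
  \<comment> \<open>Chosen so that Cauchy's estimate on the disc of radius \<open>\<rho>\<close>
    yields \<open>\<delta> / 2\<close>.\<close>
  define \<epsilon> where "\<epsilon> = \<delta> * \<rho> ^ k / (2 * fact k)"
  have "\<epsilon> > 0" using \<delta> \<rho> by (simp add: \<epsilon>_def)
  then have "\<forall>\<^sub>F n in sequentially. \<forall>w\<in>cball \<mu> \<rho>. dist ((\<phi> \<circ> s) n w) (g w) < \<epsilon>"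
    using uniform_limitD[OF ulim[OF compact_cball \<rho>(2)]] by blast
  then obtain n where n: "\<forall>w\<in>cball \<mu> \<rho>. dist ((\<phi> \<circ> s) n w) (g w) < \<epsilon>"
    unfolding eventually_sequentially by blast
  have "cmod (\<phi> (s n) w) \<le> \<epsilon>" if "w \<in> cball \<mu> \<rho>" for w
    using bspec[OF n that] g0[of w] \<rho> that by (auto simp: less_imp_le)
  then have "cmod ((deriv ^^ k) (\<phi> (s n)) \<mu>) \<le> fact k * \<epsilon> / \<rho> ^ k"
    by (intro deriv_bound[OF hol\<phi> \<rho>])
  also have "\<dots> = \<delta> / 2" using \<rho> by (simp add: \<epsilon>_def)
  also have "\<dots> < \<delta>" using \<delta> by simp
  also have "\<delta> \<le> cmod ((deriv ^^ k) (\<phi> (s n)) \<mu>)"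
    using \<delta>(2)[OF fD f(2), of "s n"] unfolding \<phi>_def .
  finally show False by simp
qed

end


section \<open>Pseudo numerical ranges\<close>

lemma pseudo_num_range_form_eq:
  fixes t :: "complex \<Rightarrow> 'a::chilbert_space form"
  shows "pseudo_num_range_form \<Omega> t = {z\<in>\<Omega>. 0 \<in> closure (num_range_form (t z))}"
proof (intro equalityI subsetI)
  fix z assume z: "z \<in> pseudo_num_range_form \<Omega> t"
  have *: "\<exists>b f. bounded_form b \<and> form_norm b < \<epsilon> \<and> z \<in> \<Omega> \<and> f \<in> form_dom (t z) \<and> norm f = 1 \<and>
      form_app (t z) f f + form_app b f f = 0" if "\<epsilon> > 0" for \<epsilon>
    using z that unfolding pseudo_num_range_form_def fam_num_range_form_def num_range_form_def form_plus_def
    by fastforce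
  have "\<exists>v\<in>num_range_form (t z). dist v 0 < \<epsilon>" if \<epsilon>: "\<epsilon> > 0" for \<epsilon>
  proof -
    obtain b f where b: "bounded_form b" "form_norm b < \<epsilon>" and f: "f \<in> form_dom (t z)" "norm f = 1"
      and eq: "form_app (t z) f f + form_app b f f = 0"
      using *[OF \<epsilon>] by blast
    obtain K where K: "\<And>f g. cmod (form_app b f g) \<le> K * norm f * norm g"
      using b(1) unfolding bounded_form_def by blast
    \<comment> \<open>\<open>form_norm\<close> is a real supremum; it dominates a single value only
      once the set is known to be bounded above.\<close>
    have "bdd_above {cmod (form_app b f g) | f g. norm f = 1 \<and> norm g = 1}"
    proof (rule bdd_aboveI[of _ K])
      fix x assume "x \<in> {cmod (form_app b f g) | f g. norm f = 1 \<and> norm g = 1}"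
      then obtain f g where "x = cmod (form_app b f g)" "norm f = 1" "norm g = 1" by blast
      then show "x \<le> K" using K[of f g] by simp
    qed
    then have "cmod (form_app b f f) \<le> form_norm b"
      unfolding form_norm_def using f by (intro cSup_upper) auto
    moreover have "form_app (t z) f f = - form_app b f f" using eq by (simp add: eq_neg_iff_add_eq_0)
    ultimately have "cmod (form_app (t z) f f) < \<epsilon>" using b by simp
    moreover have "form_app (t z) f f \<in> num_range_form (t z)" using f by (auto simp: num_range_form_def)
    ultimately show ?thesis by (intro bexI[of _ "form_app (t z) f f"]) simp_all
  qed
  moreover have "z \<in> \<Omega>" using *[of 1] by auto
  ultimately show "z \<in> {z\<in>\<Omega>. 0 \<in> closure (num_range_form (t z))}"
    unfolding closure_approachable by blast
next
  fix z assume "z \<in> {z\<in>\<Omega>. 0 \<in> closure (num_range_form (t z))}"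
  then have z: "z \<in> \<Omega>" "\<And>\<epsilon>. \<epsilon> > 0 \<Longrightarrow> \<exists>v\<in>num_range_form (t z). dist v 0 < \<epsilon>"
    unfolding closure_approachable by auto
  have "\<exists>b. bounded_form b \<and> form_norm b < \<epsilon> \<and> z \<in> fam_num_range_form \<Omega> (\<lambda>z. form_plus (t z) b)"
    if \<epsilon>: "\<epsilon> > 0" for \<epsilon>
  proof -
    obtain v where "v \<in> num_range_form (t z)" "dist v 0 < \<epsilon>" using z(2)[OF \<epsilon>] by blast
    then obtain f where f: "f \<in> form_dom (t z)" "norm f = 1" "cmod (form_app (t z) f f) < \<epsilon>"
      by (auto simp: num_range_form_def)
    define v where "v = - form_app (t z) f f"
    \<comment> \<open>The multiple of the inner product that cancels the form value at this very
      \<open>f\<close>.\<close>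
    define b where "b = \<lparr>form_dom = (UNIV :: 'a set), form_app = (\<lambda>g h. v * cinner g h)\<rparr>"
    have "sesquilinear_form b"
      unfolding sesquilinear_form_iff using sesqui_on_mult[OF sesqui_on_cinner[of UNIV], of v]
      by (simp add: b_def csubspace_def)
    moreover have bd: "cmod (form_app b g h) \<le> cmod v * norm g * norm h" for g h
      using mult_left_mono[OF cinner_Cauchy_Schwarz[of g h], of "cmod v"] by (simp add: b_def norm_mult mult.assoc)
    ultimately have "bounded_form b" unfolding bounded_form_def by (auto simp: b_def)
    moreover have "form_norm b \<le> cmod v"
      unfolding form_norm_def
    proof (rule cSup_least)
      \<comment> \<open>Bounding the supremum needs a nonempty set; the unit vector \<open>f\<close>
        provides an element.\<close>
      have "cmod (form_app b f f) \<in> {cmod (form_app b g h) | g h. norm g = 1 \<and> norm h = 1}"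
        unfolding mem_Collect_eq using f(2) by (intro exI[of _ f] conjI refl)
      then show "{cmod (form_app b g h) | g h. norm g = 1 \<and> norm h = 1} \<noteq> {}" by auto
      fix x assume "x \<in> {cmod (form_app b g h) | g h. norm g = 1 \<and> norm h = 1}"
      then obtain g h where "x = cmod (form_app b g h)" "norm g = 1" "norm h = 1" by blast
      then show "x \<le> cmod v" using bd[of g h] by simp
    qed
    moreover have "cmod v < \<epsilon>" using f by (simp add: v_def)
    moreover have "z \<in> fam_num_range_form \<Omega> (\<lambda>z. form_plus (t z) b)"
      using z(1) f unfolding fam_num_range_form_def num_range_form_def form_plus_def
      by (auto simp: b_def v_def cinner_self intro!: exI[of _ f])
    ultimately show ?thesis by fastforce
  qed
  then show "z \<in> pseudo_num_range_form \<Omega> t" unfolding pseudo_num_range_form_def by blast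
qed

lemma pseudo_num_range_op_eq:
  fixes T :: "complex \<Rightarrow> 'a::chilbert_space oper"
  shows "pseudo_num_range_op \<Omega> T = {z\<in>\<Omega>. 0 \<in> closure (num_range_op (T z))}"
proof (intro equalityI subsetI)
  fix z assume z: "z \<in> pseudo_num_range_op \<Omega> T"
  have *: "\<exists>B f. bounded_op B \<and> onorm (op_app B) < \<epsilon> \<and> z \<in> \<Omega> \<and> f \<in> op_dom (T z) \<and> norm f = 1 \<and>
      cinner (op_app (T z) f + op_app B f) f = 0" if "\<epsilon> > 0" for \<epsilon>
    using z that unfolding pseudo_num_range_op_def fam_num_range_op_def num_range_op_def op_plus_def
    by fastforce
  have "\<exists>v\<in>num_range_op (T z). dist v 0 < \<epsilon>" if \<epsilon>: "\<epsilon> > 0" for \<epsilon>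
  proof -
    obtain B f where B: "bounded_op B" "onorm (op_app B) < \<epsilon>" and f: "f \<in> op_dom (T z)" "norm f = 1"
      and eq: "cinner (op_app (T z) f + op_app B f) f = 0"
      using *[OF \<epsilon>] by blast
    have "cmod (cinner (op_app B f) f) \<le> norm (op_app B f)"
      using cinner_Cauchy_Schwarz[of "op_app B f" f] f by simp
    also have "\<dots> \<le> onorm (op_app B)"
      using onorm[of "op_app B" f] B f by (simp add: bounded_op_def)
    also note B(2)
    also have "cinner (op_app B f) f = - cinner (op_app (T z) f) f"
      using eq by (simp add: cinner_add_left eq_neg_iff_add_eq_0 add.commute)
    finally have "cmod (cinner (op_app (T z) f) f) < \<epsilon>" by simp
    moreover have "cinner (op_app (T z) f) f \<in> num_range_op (T z)" using f by (auto simp: num_range_op_def)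
    ultimately show ?thesis by (intro bexI[of _ "cinner (op_app (T z) f) f"]) simp_all
  qed
  moreover have "z \<in> \<Omega>" using *[of 1] by auto
  ultimately show "z \<in> {z\<in>\<Omega>. 0 \<in> closure (num_range_op (T z))}"
    unfolding closure_approachable by blast
next
  fix z assume "z \<in> {z\<in>\<Omega>. 0 \<in> closure (num_range_op (T z))}"
  then have z: "z \<in> \<Omega>" "\<And>\<epsilon>. \<epsilon> > 0 \<Longrightarrow> \<exists>v\<in>num_range_op (T z). dist v 0 < \<epsilon>"
    unfolding closure_approachable by auto
  have "\<exists>B. bounded_op B \<and> onorm (op_app B) < \<epsilon> \<and> z \<in> fam_num_range_op \<Omega> (\<lambda>z. op_plus (T z) B)"
    if \<epsilon>: "\<epsilon> > 0" for \<epsilon>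
  proof -
    obtain v where "v \<in> num_range_op (T z)" "dist v 0 < \<epsilon>" using z(2)[OF \<epsilon>] by blast
    then obtain f where f: "f \<in> op_dom (T z)" "norm f = 1" "cmod (cinner (op_app (T z) f) f) < \<epsilon>"
      by (auto simp: num_range_op_def)
    define v where "v = - cinner (op_app (T z) f) f"
    define B where "B = \<lparr>op_dom = (UNIV :: 'a set), op_app = (\<lambda>g. v *\<^sub>C g)\<rparr>"
    have "linear_op B"
      by (simp add: linear_op_def B_def csubspace_def scaleC_add_right scaleC_scaleC mult.commute)
    moreover have "bounded_linear (op_app B)"
      by (rule bounded_linear_intro[of _ "cmod v"])
         (simp_all add: B_def scaleC_add_right scaleC_scaleC norm_scaleC mult.commute flip: scaleC_of_real)
    ultimately have "bounded_op B" by (simp add: bounded_op_def B_def)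
    moreover have "onorm (op_app B) \<le> cmod v" by (rule onorm_bound) (simp_all add: B_def norm_scaleC)
    moreover have "cmod v < \<epsilon>" using f by (simp add: v_def)
    moreover have "z \<in> fam_num_range_op \<Omega> (\<lambda>z. op_plus (T z) B)"
      using z(1) f unfolding fam_num_range_op_def num_range_op_def op_plus_def
      by (auto simp: B_def v_def cinner_self cinner_add_left cinner_scaleC_left intro!: exI[of _ f])
    ultimately show ?thesis by fastforce
  qed
  then show "z \<in> pseudo_num_range_op \<Omega> T" unfolding pseudo_num_range_op_def by blast
qed

section \<open>Comparison of an operator with its form\<close>

lemma associated_num_range_op:
  assumes "associated_op a A"
  shows "num_range_op A = {form_app a f f | f. f \<in> op_dom A \<and> norm f = 1}"
proof -
  have "cinner (op_app A f) f = form_app a f f" if "f \<in> op_dom A" for f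
    using assms that by (auto simp: associated_op_def)
  then show ?thesis unfolding num_range_op_def by (intro Collect_cong) metis
qed

text \<open>The operator domain is \<open>p\<close>-dense, also among unit vectors, and the
  quadratic form is \<open>p\<close>-continuous; so small form values are nearly attained on
  \<open>op_dom A\<close>.\<close>

lemma zero_in_closure_num_range_associated:
  assumes a: "closed_sectorial_form a" and A: "associated_op a A"
    and 0: "0 \<in> closure (num_range_form a)"
  shows "0 \<in> closure (num_range_op A)"
  unfolding closure_approachable
proof (intro allI impI)
  fix e :: real assume e: "e > 0"
  obtain p c C where n: "closed_form_norm (form_dom a) p (form_app a) c C"
    using closed_sectorial_form_norm[OF a] by blast
  then interpret closed_form_norm "form_dom a" p "form_app a" c C .
  have E: "csubspace (op_dom A)" "op_dom A \<subseteq> form_dom a"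
    using A by (auto simp: associated_op_def m_sectorial_def linear_op_def)
  have "e / 2 > 0" using e by simp
  then obtain f where f: "f \<in> form_dom a" "norm f = 1" "cmod (form_app a f f) < e / 2"
    using 0 unfolding closure_approachable num_range_form_def by fastforce
  define L where "L = 2 * C * (2 * p f + 1)"
  have L: "L \<ge> 0" using C_nonneg nonneg[OF f(1)] by (simp add: L_def)
  \<comment> \<open>The cap \<open>1\<close> bounds \<open>p (f + g)\<close> by
    \<open>2 * p f + 1\<close>, and the summand in \<open>L + 1\<close> covers
    \<open>L = 0\<close>.\<close>
  define \<eta> where "\<eta> = min 1 (e / (2 * (L + 1)))"
  have \<eta>: "\<eta> > 0" "\<eta> \<le> 1" "\<eta> \<le> e / (2 * (L + 1))"
    using e L unfolding \<eta>_def by (simp, intro min.cobounded1, intro min.cobounded2)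
  obtain g where g: "g \<in> op_dom A" "norm g = 1" "p (f - g) < \<eta>"
    using unit_dense[OF E associated_op_dom_dense[OF A n f(1)] f(1,2) \<eta>(1)] by blast
  have gD: "g \<in> form_dom a" using g E by blast
  have pg: "p (f + g) \<le> 2 * p f + 1"
    using triangle_diff[OF scale_mem[OF f(1), of 2] diff_mem[OF f(1) gD]] scale[OF f(1), of 2] g \<eta>
    by (simp add: scaleR_2 algebra_simps)
  have "cmod (form_app a f f - form_app a g g) \<le> 2 * C * p (f + g) * p (f - g)"
    by (rule sesqui_diff_bound[OF complete_norm_on_axioms sesqui bound f(1) gD])
  also have "\<dots> \<le> L * p (f - g)"
    using pg C_nonneg nonneg[OF diff_mem[OF f(1) gD]] unfolding L_def
    by (intro mult_right_mono mult_left_mono) auto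
  also have "\<dots> \<le> L * (e / (2 * (L + 1)))" using g \<eta> L by (intro mult_left_mono) auto
  also have "\<dots> \<le> e / 2" using L e by (simp add: field_simps)
  finally have "cmod (form_app a g g) < e"
    using f(3) norm_triangle_ineq2[of "form_app a g g" "form_app a f f"] by (simp add: norm_minus_commute)
  then show "\<exists>v\<in>num_range_op A. dist v 0 < e"
    unfolding associated_num_range_op[OF A] using g by (intro bexI[of _ "form_app a g g"]) auto
qed

theorem theorem3p3:
  fixes \<Omega> :: "complex set"
    and t :: "complex \<Rightarrow> 'a::chilbert_space form"
    and T :: "complex \<Rightarrow> 'a oper"
  assumes "open \<Omega>" and "connected \<Omega>" and "\<Omega> \<noteq> {}"
    and "holomorphic_type_a \<Omega> t"
    and "associated_type_B \<Omega> t T"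
    and "\<exists>(k::nat) \<mu> D. \<mu> \<in> \<Omega> \<and> form_core (t \<mu>) D \<and>
           0 \<notin> closure (num_range_form (form_restrict (form_deriv t k \<mu>) D))"
  shows "fam_spectrum \<Omega> T \<subseteq> pseudo_num_range_form \<Omega> t \<and>
         pseudo_num_range_form \<Omega> t = closure (fam_num_range_form \<Omega> t) \<inter> \<Omega> \<and>
         ((\<forall>z\<in>\<Omega>. \<forall>w\<in>\<Omega>. op_dom (T z) = op_dom (T w)) \<longrightarrow>
            fam_spectrum \<Omega> T \<subseteq> pseudo_num_range_op \<Omega> T \<and>
            pseudo_num_range_op \<Omega> T = closure (fam_num_range_op \<Omega> T) \<inter> \<Omega>)"
proof -
  obtain k \<mu> E where \<mu>: "\<mu> \<in> \<Omega>" "form_core (t \<mu>) E"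
    "0 \<notin> closure (num_range_form (form_restrict (form_deriv t k \<mu>) E))"
    using assms(6) by blast
  define D where "D = form_dom (t \<mu>)"
  interpret type_a_family \<Omega> t D
  proof
    show dom: "form_dom (t z) = D" if "z \<in> \<Omega>" for z
      using assms(4) that \<mu>(1) unfolding holomorphic_type_a_def D_def by blast
    show "(\<lambda>z. form_app (t z) f f) holomorphic_on \<Omega>" if "f \<in> D" for f
      using assms(4) that \<mu>(1) unfolding holomorphic_type_a_def D_def by blast
    show "closed_sectorial_form (t z)" if "z \<in> \<Omega>" for z
      using assms(4) that unfolding holomorphic_type_a_def by blast
  qed fact
  have assoc: "associated_op (t z) (T z)" if "z \<in> \<Omega>" for z
    using assms(5) that by (simp add: associated_type_B_def)
  have domT: "op_dom (T z) \<subseteq> D" if "z \<in> \<Omega>" for z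
    using assoc[OF that] dom[OF that] by (auto simp: associated_op_def)
  have W_form: "num_range_form (t z) = {form_app (t z) f f | f. f \<in> D \<and> norm f = 1}" if "z \<in> \<Omega>" for z
    using dom[OF that] by (simp add: num_range_form_def)
  have W_op: "num_range_op (T z) = {form_app (t z) f f | f. f \<in> op_dom (T z) \<and> norm f = 1}" if "z \<in> \<Omega>" for z
    using associated_num_range_op[OF assoc[OF that]] .
  have fam_form: "fam_num_range_form \<Omega> t = {z\<in>\<Omega>. \<exists>f\<in>D. norm f = 1 \<and> form_app (t z) f f = 0}"
    using W_form by (auto simp: fam_num_range_form_def)
  have fam_op: "fam_num_range_op \<Omega> T = {z\<in>\<Omega>. \<exists>f\<in>op_dom (T z). norm f = 1 \<and> form_app (t z) f f = 0}"
    using W_op by (auto simp: fam_num_range_op_def)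
  have closures: "0 \<in> closure (num_range_op (T z)) \<longleftrightarrow> 0 \<in> closure (num_range_form (t z))" if z: "z \<in> \<Omega>" for z
  proof
    have "num_range_op (T z) \<subseteq> num_range_form (t z)"
      unfolding W_form[OF z] W_op[OF z] using domT[OF z] by blast
    then show "0 \<in> closure (num_range_form (t z))" if "0 \<in> closure (num_range_op (T z))"
      using that closure_mono by blast
    show "0 \<in> closure (num_range_op (T z))" if "0 \<in> closure (num_range_form (t z))"
      using zero_in_closure_num_range_associated[OF closed_form[OF z] assoc[OF z] that] .
  qed
  \<comment> \<open>Since both pseudo numerical ranges are the same set, \<open>spec\<close> is
    shown for the operators, \<open>upper\<close> for the forms, and each is transferred.\<close>
  have pseudo: "pseudo_num_range_op \<Omega> T = pseudo_num_range_form \<Omega> t"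
    unfolding pseudo_num_range_op_eq pseudo_num_range_form_eq using closures by blast
  have spec: "fam_spectrum \<Omega> T \<subseteq> pseudo_num_range_op \<Omega> T"
  proof
    fix z assume "z \<in> fam_spectrum \<Omega> T"
    then have z: "z \<in> \<Omega>" "0 \<notin> resolvent_set (T z)" by (auto simp: fam_spectrum_def spectrum_def)
    then have "0 \<in> closure (num_range_op (T z))"
      using m_sectorial_zero_in_resolvent_set[of "T z"] assoc[of z] by (auto simp: associated_op_def)
    then show "z \<in> pseudo_num_range_op \<Omega> T" using z by (simp add: pseudo_num_range_op_eq)
  qed
  have upper: "closure (fam_num_range_form \<Omega> t) \<inter> \<Omega> \<subseteq> pseudo_num_range_form \<Omega> t"
    using zero_in_closure_num_range W_form unfolding fam_form pseudo_num_range_form_eq by auto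
  obtain \<delta> where \<delta>: "\<delta> > 0"
    "\<And>f. f \<in> D \<Longrightarrow> norm f = 1 \<Longrightarrow> \<delta> \<le> cmod ((deriv ^^ k) (\<lambda>w. form_app (t w) f f) \<mu>)"
    using deriv_lower_bound[OF \<mu>] by blast
  \<comment> \<open>The set of admissible vectors is left open: it will be \<open>D\<close> for the
    forms and \<open>dom T(z)\<close> for the operators.\<close>
  note zeros = in_closure_zeros[OF assms(2) \<mu>(1) _ \<delta>]
  have form_eq: "pseudo_num_range_form \<Omega> t = closure (fam_num_range_form \<Omega> t) \<inter> \<Omega>"
  proof
    show "pseudo_num_range_form \<Omega> t \<subseteq> closure (fam_num_range_form \<Omega> t) \<inter> \<Omega>"
      using zeros[OF _ _ _ subset_refl] W_form unfolding fam_form pseudo_num_range_form_eq by auto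
  qed (rule upper)
  have op_eq: "pseudo_num_range_op \<Omega> T = closure (fam_num_range_op \<Omega> T) \<inter> \<Omega>"
    if const: "\<forall>z\<in>\<Omega>. \<forall>w\<in>\<Omega>. op_dom (T z) = op_dom (T w)"
  proof
    show "pseudo_num_range_op \<Omega> T \<subseteq> closure (fam_num_range_op \<Omega> T) \<inter> \<Omega>"
    proof
      fix z assume "z \<in> pseudo_num_range_op \<Omega> T"
      then have z: "z \<in> \<Omega>" and 0: "0 \<in> closure (num_range_op (T z))"
        by (auto simp: pseudo_num_range_op_eq)
      have "z \<in> closure {w\<in>\<Omega>. \<exists>f\<in>op_dom (T z). norm f = 1 \<and> form_app (t w) f f = 0}"
        using zeros[OF z _ _ domT[OF z]] 0 unfolding W_op[OF z] by blast
      \<comment> \<open>A vector of \<open>dom T(z)\<close> at which \<open>t(w)\<close> vanishes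
        lies in \<open>dom T(w)\<close> by \<open>const\<close>, so the zero \<open>w\<close>
        belongs to \<open>W(T)\<close>.\<close>
      also have "{w\<in>\<Omega>. \<exists>f\<in>op_dom (T z). norm f = 1 \<and> form_app (t w) f f = 0} = fam_num_range_op \<Omega> T"
        unfolding fam_op using const z by blast
      finally show "z \<in> closure (fam_num_range_op \<Omega> T) \<inter> \<Omega>" using z by blast
    qed
    have "fam_num_range_op \<Omega> T \<subseteq> fam_num_range_form \<Omega> t"
      unfolding fam_op fam_form using domT by blast
    then show "closure (fam_num_range_op \<Omega> T) \<inter> \<Omega> \<subseteq> pseudo_num_range_op \<Omega> T"
      using upper closure_mono unfolding pseudo by blast
  qed
  show ?thesis
    using spec form_eq op_eq unfolding pseudo by (intro conjI impI)
qed

end
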